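(* Let $Q_2(x_1,\ldots,x_{24})=\sum_{i=1}^{24}x_i^2$, let $r_{Q_2}(n)=\#\{\vec{x}\in\mathbb{Z}^{24}:Q_2(\vec{x})=n\}$, and let $n$ be a positive integer. Then $$r_{Q_2}(n)=\frac{16}{691}\left(\sigma_{11}(n)-2\sigma_{11}(n/2)+4096\,\sigma_{11}(n/4)\right)$$ if and only if $\tau_{12}(n)=0$.
   Context: $\tau_{12}(n)$ is the Ramanujan tau function, defined by $q\prod_{m\ge1}(1-q^m)^{24}=\sum_{n\ge1}\tau_{12}(n)q^n$. $\sigma_{11}(m)=\sum_{d\mid m}d^{11}$ for a positive integer $m$, and $\sigma_{11}(y)=0$ if $y$ is not an integer. *)

theory Defs
  imports "HOL-Analysis.Analysis"
begin

text \<open>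
  The infinite product is the library's \<open>prodinf\<close> (indexed from 0, hence \<open>Suc m\<close>), taken with
  respect to the \<open>X\<close>-adic metric on formal power series.
\<close>
definition ramanujan_tau :: "nat \<Rightarrow> int" where
  "ramanujan_tau n = fps_nth (fps_X * (\<Prod>m. (1 - fps_X ^ Suc m) ^ 24)) n"

text \<open>
  Since \<open>prodinf\<close> is a definite description, the product in \<open>ramanujan_tau\<close> is only meaningful
  because it converges:
\<close>
lemma ramanujan_tau_has_prod:
  "(\<lambda>m. (1 - fps_X ^ Suc m) ^ 24 :: int fps) has_prod (\<Prod>m. (1 - fps_X ^ Suc m) ^ 24)"
proof -
  let ?f = "\<lambda>m. (1 - fps_X ^ Suc m) ^ 24 :: int fps"
  have nth0: "fps_nth (?f m) 0 = 1" for m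
    by (simp add: fps_nth_power_0)
  have nth_prod: "fps_nth (\<Prod>k\<le>N + m. ?f k) n = fps_nth (\<Prod>k\<le>N. ?f k) n" if "n \<le> N" for N m n
  proof (induction m)
    case (Suc m)
    let ?P = "\<Prod>k\<le>N + m. ?f k" and ?Y = "fps_X ^ Suc (N + Suc m) :: int fps"
    have "?f (N + Suc m) = 1 + ?Y * - (\<Sum>i<24. (1 - ?Y) ^ i)"
      using power_diff_1_eq[of "1 - ?Y" 24] by (simp add: algebra_simps del: power_Suc)
    then obtain h where h: "?f (N + Suc m) = 1 + ?Y * h" by blast
    have "(\<Prod>k\<le>N + Suc m. ?f k) = ?P * ?f (N + Suc m)"
      by (simp del: power_Suc)
    also have "\<dots> = ?P + ?Y * (?P * h)"
      unfolding h by (simp add: algebra_simps del: power_Suc)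
    finally have "fps_nth (\<Prod>k\<le>N + Suc m. ?f k) n = fps_nth ?P n"
      using that by (simp add: fps_X_power_mult_nth del: power_Suc)
    with Suc.IH show ?case by simp
  qed simp
  define P where "P = Abs_fps (\<lambda>n. fps_nth (\<Prod>k\<le>n. ?f k) n)"
  have "(\<lambda>N. \<Prod>k\<le>N. ?f k) \<longlonglongrightarrow> P"
  proof (rule tendsto_fpsI)
    fix n
    show "\<forall>\<^sub>F N in sequentially. fps_nth (\<Prod>k\<le>N. ?f k) n = fps_nth P n"
      using eventually_ge_at_top[of n]
    proof eventually_elim
      case (elim N)
      thus ?case using nth_prod[of n n "N - n"] by (simp add: P_def del: power_Suc)
    qed
  qed
  moreover have "fps_nth P 0 = 1"
    using nth0[of 0] by (simp add: P_def)
  hence "P \<noteq> 0" by auto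
  ultimately have "?f has_prod P"
    by (simp add: has_prod_def raw_has_prod_def del: power_Suc)
  with has_prod_unique[OF this] show ?thesis by (simp del: power_Suc)
qed

text \<open>
  The argument is a real number so that \<open>n / 2\<close> and \<open>n / 4\<close> denote exact quotients. Only positive
  arguments are meaningful.
\<close>
definition sigma11 :: "real \<Rightarrow> real" where
  "sigma11 y = (if y \<in> \<int> then \<Sum>d | d dvd nat \<lfloor>y\<rfloor>. real d ^ 11 else 0)"

definition Q2 :: "int ^ 24 \<Rightarrow> int" where
  "Q2 x = (\<Sum>i\<in>UNIV. (x $ i)\<^sup>2)"

definition num_reps :: "(int ^ 'k \<Rightarrow> int) \<Rightarrow> nat \<Rightarrow> nat" where
  "num_reps Q n = card {x. Q x = int n}"

end

theory Submission
  imports Defs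
begin

text \<open>
  The number of representations as a sum of 24 squares is the sum of the divisor expression in the
  theorem and a multiple of \<open>259 (-1)\<^sup>n \<tau>(n) + 512 \<tau>(n/2)\<close> (\<open>num_reps_Q2_formula\<close>).  For
  odd \<open>n\<close> this vanishes iff \<open>\<tau>(n)\<close> does.  For even \<open>n\<close> the Hecke relation
  \<open>\<tau>(2m) = -24 \<tau>(m) - 2048 \<tau>(m/2)\<close> shows that the two terms have different 2-adic valuations
  unless both are zero (\<open>tau_term_eq_0_iff\<close>).

  The formula and the Hecke relation are identities between polynomials in \<open>a = \<theta>\<^sub>3\<^sup>4\<close> and
  \<open>b = \<theta>\<^sub>4\<^sup>4\<close>, once the Eisenstein series and the discriminant are known as such polynomials.
  Everything happens in the ring of formal power series in \<open>q\<close>, in three steps.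

  Writing a pair of integers of equal parity as \<open>(u + v, u - v)\<close> yields the effect of
  \<open>q \<mapsto> q\<^sup>2\<close> on \<open>\<theta>\<^sub>3\<^sup>2\<close> and \<open>\<theta>\<^sub>4\<^sup>2\<close>.  This determines their derivatives up to one unknown
  series \<open>theta_P\<close>: an error term in the expected differential equation is, up to a constant
  factor, invariant under \<open>q \<mapsto> q\<^sup>2\<close>, and is therefore a constant, which is found by comparing
  leading coefficients (\<open>theta_a_theta_b_wronskian\<close>, \<open>fps_XD_theta_P\<close>).  So \<open>theta_P\<close> and two explicit
  polynomials \<open>theta_Q\<close>, \<open>theta_R\<close> in \<open>a\<close> and \<open>b\<close> satisfy Ramanujan's differential equations.

  The Eisenstein series of weights 2, 4 and 6 satisfy the same equations.  These are statements on
  convolutions of divisor sums, as is the formula for \<open>E\<^sub>1\<^sub>2\<close> as a polynomial in \<open>E\<^sub>4\<close> and \<open>E\<^sub>6\<close>.  All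
  of them follow from one rearrangement of the solutions of \<open>a x + b y = n\<close>
  (\<open>quads_sum_identity\<close>), applied to five polynomials (\<open>sig_relation\<close>).

  The solution of Ramanujan's equations is unique (\<open>ramanujan_system_unique\<close>), so the Eisenstein
  series equal the theta polynomials.  In particular \<open>theta_P\<close> is the logarithmic derivative
  both of the product that defines \<open>\<tau>\<close> and of \<open>a b\<^sup>4 (a - b)\<close>, which makes the two proportional
  (\<open>tau_series_eq\<close>).
\<close>

section \<open>Operators on power series\<close>

lemma fps_XD_add: "fps_XD (f + g) = fps_XD f + fps_XD g"
  by (simp add: fps_eq_iff algebra_simps)

lemma fps_XD_diff: "fps_XD (f - g) = fps_XD f - fps_XD (g :: 'a::comm_ring_1 fps)"
  by (simp add: fps_eq_iff algebra_simps)

lemma fps_XD_mult: "fps_XD (f * g) = fps_XD f * g + f * fps_XD (g :: 'a::comm_ring_1 fps)"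
  by (simp add: fps_XD_def algebra_simps)

lemma fps_XD_numeral [simp]: "fps_XD (numeral k :: 'a::comm_ring_1 fps) = 0"
  by (simp add: fps_XD_def)

definition dbl :: "'a::idom fps \<Rightarrow> 'a fps" where
  "dbl f = f oo fps_X ^ 2"

lemma dbl_nth: "fps_nth (dbl f) n = (if even n then fps_nth f (n div 2) else 0)"
proof -
  have "fps_nth (dbl f) n = (\<Sum>i = 0..n. if n = 2 * i then fps_nth f i else 0)"
    unfolding dbl_def fps_compose_nth by (rule sum.cong) (simp_all flip: power_mult)
  also have "\<dots> = (\<Sum>i \<in> {0..n} \<inter> {i. n = 2 * i}. fps_nth f i)"
    by (simp add: sum.If_cases)
  also have "{0..n} \<inter> {i. n = 2 * i} = (if even n then {n div 2} else {})"
    by auto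
  finally show ?thesis by simp
qed

lemma dbl_add: "dbl (f + g) = dbl f + dbl g"
  by (simp add: dbl_def fps_compose_add_distrib)

lemma dbl_diff: "dbl (f - g) = dbl f - dbl g"
  by (simp add: dbl_def fps_compose_sub_distrib)

lemma dbl_mult: "dbl (f * g) = dbl f * dbl g"
  by (simp add: dbl_def fps_compose_mult_distrib)

lemma dbl_power: "dbl (f ^ k) = dbl f ^ k"
  by (induction k) (simp_all add: dbl_mult, simp add: dbl_def)

lemma dbl_numeral [simp]: "dbl (numeral k) = numeral k"
  by (simp add: dbl_def)

lemma fps_XD_dbl: "fps_XD (dbl f) = 2 * dbl (fps_XD f)"
  by (auto simp: fps_eq_iff dbl_nth numeral_fps_const elim!: evenE)

lemmas dbl_simps = dbl_add dbl_diff dbl_mult dbl_power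

definition alt :: "'a::idom fps \<Rightarrow> 'a fps" where
  "alt f = f oo (- fps_X)"

lemma alt_nth: "fps_nth (alt f) n = (-1) ^ n * fps_nth f n"
  using fps_nth_compose_linear[of f "-1" n] by (simp add: alt_def flip: fps_const_neg)

lemma alt_diff: "alt (f - g) = alt f - alt g"
  by (simp add: alt_def fps_compose_sub_distrib)

lemma alt_mult: "alt (f * g) = alt f * alt g"
  by (simp add: alt_def fps_compose_mult_distrib)

lemma alt_power: "alt (f ^ k) = alt f ^ k"
  by (induction k) (simp_all add: alt_mult, simp add: alt_def)

lemma alt_alt: "alt (alt f) = f"
  by (simp add: fps_eq_iff alt_nth flip: mult.assoc power_add)

lemma alt_numeral [simp]: "alt (numeral k) = numeral k"
  by (simp add: alt_def)

text \<open>
  Since \<open>dbl\<close> spreads the coefficients out, an equation \<open>f = c dbl f\<close> propagates the vanishing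
  of the odd coefficients to all others.  Only the constant term can survive, and only if \<open>c = 1\<close>.
\<close>
lemma dbl_eigen_nth_eq_0:
  assumes "f = fps_const c * dbl f" "n > 0"
  shows "fps_nth f n = 0"
  using assms(2)
proof (induction n rule: less_induct)
  case (less n)
  have "fps_nth f n = c * (if even n then fps_nth f (n div 2) else 0)"
    by (subst assms(1)) (simp add: dbl_nth)
  with less.IH[of "n div 2"] less.prems show ?case by (auto elim!: evenE)
qed

section \<open>The theta series of the squares\<close>

definition square_series :: "(int \<Rightarrow> real) \<Rightarrow> real fps" where
  "square_series u = Abs_fps (\<lambda>n. \<Sum>x | x\<^sup>2 = int n. u x)"

lemma abs_le_square: "\<bar>x::int\<bar> \<le> x\<^sup>2"
  using self_le_power[of "\<bar>x\<bar>" 2] by (cases "x = 0") auto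

lemma in_interval_if_square_le: "(x::int)\<^sup>2 \<le> int n \<Longrightarrow> x \<in> {- int n..int n}"
  using abs_le_square[of x] by auto

lemma finite_int_sqrt [simp]: "finite {x::int. x\<^sup>2 = int n}"
proof (rule finite_subset)
  show "{x::int. x\<^sup>2 = int n} \<subseteq> {- int n..int n}"
    by (intro subsetI in_interval_if_square_le) simp
qed simp

lemma finite_two_squares [simp]: "finite {(x, y). (x::int)\<^sup>2 + y\<^sup>2 = int n}"
proof (rule finite_subset)
  have "x\<^sup>2 \<le> int n" "y\<^sup>2 \<le> int n" if "x\<^sup>2 + y\<^sup>2 = int n" for x y :: int
    using that zero_le_power2[of x] zero_le_power2[of y] by linarith+
  then show "{(x, y). (x::int)\<^sup>2 + y\<^sup>2 = int n} \<subseteq> {- int n..int n} \<times> {- int n..int n}"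
    using in_interval_if_square_le by blast
qed simp

lemma square_series_mult_nth:
  "fps_nth (square_series u * square_series v) n =
     (\<Sum>(x, y) | x\<^sup>2 + y\<^sup>2 = int n. u x * v y)"
proof -
  define S where "S i = {x::int. x\<^sup>2 = int i} \<times> {y::int. y\<^sup>2 = int (n - i)}" for i
  have "fps_nth (square_series u * square_series v) n = (\<Sum>i=0..n. \<Sum>(x,y)\<in>S i. u x * v y)"
    by (simp add: fps_mult_nth square_series_def sum_product sum.cartesian_product S_def)
  also have "\<dots> = (\<Sum>(x,y)\<in>(\<Union>i\<in>{0..n}. S i). u x * v y)"
    by (rule sum.UNION_disjoint [symmetric])
      (auto simp: S_def simp del: of_nat_diff)
  also have "(\<Union>i\<in>{0..n}. S i) = {(x, y). x\<^sup>2 + y\<^sup>2 = int n}"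
  proof (intro equalityI subsetI; clarify)
    fix x y :: int assume "x\<^sup>2 + y\<^sup>2 = int n"
    moreover from this have "nat (x\<^sup>2) \<le> n"
      using zero_le_power2[of y] unfolding nat_le_iff by linarith
    ultimately have "nat (x\<^sup>2) \<le> n" "(x, y) \<in> S (nat (x\<^sup>2))"
      by (auto simp: S_def of_nat_diff)
    then show "(x, y) \<in> (\<Union>i\<in>{0..n}. S i)" by auto
  qed (auto simp: S_def of_nat_diff)
  finally show ?thesis .
qed

definition altsgn :: "int \<Rightarrow> real" where
  "altsgn x = (if even x then 1 else - 1)"

definition theta :: "real fps" where
  "theta = square_series (\<lambda>_. 1)"

text \<open>
  A square has the parity of its root, so the sign may be read off the root instead of the exponent.
\<close>
lemma alt_theta_eq: "alt theta = square_series altsgn"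
proof (rule fps_ext)
  fix n
  have "altsgn x = (-1) ^ n" if "x\<^sup>2 = int n" for x
  proof -
    have "even x \<longleftrightarrow> even n" using that by (metis even_of_nat even_power pos2)
    then show ?thesis by (simp add: altsgn_def)
  qed
  then show "fps_nth (alt theta) n = fps_nth (square_series altsgn) n"
    by (simp add: alt_nth theta_def square_series_def)
qed

text \<open>
  The map \<open>(u, v) \<mapsto> (u + v, u - v)\<close> doubles \<open>u\<^sup>2 + v\<^sup>2\<close> and has as its image the pairs of
  equal parity.
\<close>
lemma sum_two_squares_double:
  "(\<Sum>(x, y) | x\<^sup>2 + y\<^sup>2 = int (2 * m). h x y) = (\<Sum>(x, y) | x\<^sup>2 + y\<^sup>2 = int m. h (x + y) (x - y))"
proof (rule sum.reindex_bij_witness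
    [of _ "\<lambda>(x, y). (x + y, x - y)" "\<lambda>(x, y). ((x + y) div 2, (x - y) div 2)"])
  fix p :: "int \<times> int" assume p: "p \<in> {(x, y). x\<^sup>2 + y\<^sup>2 = int (2 * m)}"
  obtain x y where xy: "p = (x, y)" by force
  from p xy have *: "x\<^sup>2 + y\<^sup>2 = 2 * int m" by simp
  then have "even (x\<^sup>2 + y\<^sup>2)" by simp
  then have "even (x + y)" by simp
  then obtain u where u: "x + y = 2 * u" by blast
  define v where "v = x - u"
  have x: "x = u + v" and y: "y = u - v" using u by (auto simp: v_def)
  have "2 * (u\<^sup>2 + v\<^sup>2) = 2 * int m" using * by (simp add: x y power2_eq_square algebra_simps)
  moreover have "(x + y) div 2 = u" "(x - y) div 2 = v" by (simp_all add: x y)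
  ultimately show "(case p of (x, y) \<Rightarrow> ((x + y) div 2, (x - y) div 2)) \<in> {(x, y). x\<^sup>2 + y\<^sup>2 = int m}"
    "(case case p of (x, y) \<Rightarrow> ((x + y) div 2, (x - y) div 2) of (x, y) \<Rightarrow> (x + y, x - y)) = p"
    "(case case p of (x, y) \<Rightarrow> ((x + y) div 2, (x - y) div 2) of
          (x, y) \<Rightarrow> h (x + y) (x - y)) = (case p of (x, y) \<Rightarrow> h x y)"
    by (simp_all add: xy x y)
qed (auto simp: power2_eq_square algebra_simps)

lemma odd_sum_two_squares: "(x::int)\<^sup>2 + y\<^sup>2 = int n \<Longrightarrow> odd n \<Longrightarrow> odd (x + y)"
  by (metis even_add even_of_nat even_power pos2)

text \<open>
  The left side counts each pair of integers twice if its entries have equal parity and not at all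
  otherwise, and \<open>sum_two_squares_double\<close> parametrises the pairs of equal parity.
\<close>
lemma theta_square_add: "theta ^ 2 + alt theta ^ 2 = 2 * dbl (theta ^ 2)"
proof (rule fps_ext)
  fix n
  have l: "fps_nth (theta ^ 2 + alt theta ^ 2) n =
      (\<Sum>(x, y) | x\<^sup>2 + y\<^sup>2 = int n. 1 + altsgn (x + y))"
    unfolding alt_theta_eq
    unfolding theta_def power2_eq_square [where 'a = "real fps"] fps_add_nth
      square_series_mult_nth sum.distrib [symmetric]
    by (rule sum.cong) (auto simp: altsgn_def)
  have r: "fps_nth (2 * dbl (theta ^ 2)) n =
      (if even n then 2 * (\<Sum>(x, y) | x\<^sup>2 + y\<^sup>2 = int (n div 2). 1) else 0)"
    by (simp add: dbl_nth numeral_fps_const power2_eq_square theta_def square_series_mult_nth)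
  show "fps_nth (theta ^ 2 + alt theta ^ 2) n = fps_nth (2 * dbl (theta ^ 2)) n"
  proof (cases "even n")
    case True
    then obtain m where n: "n = 2 * m" by blast
    show ?thesis unfolding l r unfolding n sum_two_squares_double
      by (simp add: altsgn_def sum_distrib_left case_prod_unfold)
  next
    case False
    then have "(\<Sum>(x, y) | x\<^sup>2 + y\<^sup>2 = int n. 1 + altsgn (x + y)) = 0"
      by (intro sum.neutral) (auto simp: altsgn_def dest!: odd_sum_two_squares)
    then show ?thesis unfolding l r using False by simp
  qed
qed

lemma theta_mult_alt: "theta * alt theta = dbl (alt theta ^ 2)"
proof (rule fps_ext)
  fix n
  have l: "fps_nth (theta * alt theta) n = (\<Sum>(x, y) | x\<^sup>2 + y\<^sup>2 = int n. altsgn y)"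
    unfolding alt_theta_eq unfolding theta_def square_series_mult_nth by simp
  have r: "fps_nth (dbl (alt theta ^ 2)) n =
      (if even n then \<Sum>(x, y) | x\<^sup>2 + y\<^sup>2 = int (n div 2). altsgn x * altsgn y else 0)"
    by (simp add: dbl_nth power2_eq_square alt_theta_eq square_series_mult_nth)
  show "fps_nth (theta * alt theta) n = fps_nth (dbl (alt theta ^ 2)) n"
  proof (cases "even n")
    case True
    then obtain m where n: "n = 2 * m" by blast
    have "altsgn (x - y) = altsgn x * altsgn y" for x y by (auto simp: altsgn_def)
    then show ?thesis unfolding l r unfolding n sum_two_squares_double by simp
  next
    case False
    \<comment> \<open>In a pair of opposite parity the two signs are opposite, and exchanging \<open>x\<close> and \<open>y\<close>
      shows that the sum equals its own negative.\<close>
    have "(\<Sum>(x, y) | x\<^sup>2 + y\<^sup>2 = int n. altsgn y) = (\<Sum>(x, y) | x\<^sup>2 + y\<^sup>2 = int n. altsgn x)"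
      by (rule sum.reindex_bij_witness[of _ prod.swap prod.swap]) auto
    also have "\<dots> = (\<Sum>(x, y) | x\<^sup>2 + y\<^sup>2 = int n. - altsgn y)"
      using False by (intro sum.cong) (auto simp: altsgn_def dest!: odd_sum_two_squares)
    finally have "(\<Sum>(x, y) | x\<^sup>2 + y\<^sup>2 = int n. altsgn y) = 0"
      by (simp add: sum_negf case_prod_unfold)
    then show ?thesis using False by (simp add: l r)
  qed
qed

lemma theta_nth_0: "fps_nth theta 0 = 1"
proof -
  have "{x::int. x\<^sup>2 = int 0} = {0}" by auto
  then show ?thesis by (simp add: theta_def square_series_def)
qed

lemma theta_nth_1: "fps_nth theta (Suc 0) = 2"
proof -
  have "{x::int. x\<^sup>2 = int 1} = {1, - 1}" by (auto simp: power2_eq_1_iff)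
  then show ?thesis by (simp add: theta_def square_series_def)
qed

text \<open>
  Up to degree \<open>n\<close> the theta series agrees with a sum over the finite set \<open>{-n..n}\<close>, and the
  power of a finite sum expands into a sum over all vectors.
\<close>
lemma theta_power_nth:
  "fps_nth (theta ^ CARD('k)) n = real (num_reps (\<lambda>x::int^'k. \<Sum>i\<in>UNIV. (x $ i)\<^sup>2) n)"
proof -
  define T :: "real fps" where "T = (\<Sum>x\<in>{- int n..int n}. fps_X ^ nat (x\<^sup>2))"
  have T: "fps_nth theta m = fps_nth T m" if "m \<le> n" for m
  proof -
    have "fps_nth T m = (\<Sum>x\<in>{- int n..int n}. if m = nat (x\<^sup>2) then 1 else 0)"
      by (simp add: T_def fps_sum_nth)
    also have "\<dots> = (\<Sum>x\<in>{- int n..int n} \<inter> {x. m = nat (x\<^sup>2)}. 1)"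
      by (simp add: sum.If_cases)
    also have "{- int n..int n} \<inter> {x. m = nat (x\<^sup>2)} = {x. x\<^sup>2 = int m}"
    proof -
      have "x \<in> {- int n..int n}" if "x\<^sup>2 = int m" for x
        using abs_le_square[of x] that \<open>m \<le> n\<close> by auto
      then show ?thesis by auto
    qed
    finally show ?thesis by (simp add: theta_def square_series_def)
  qed
  have pow: "fps_nth (theta ^ k) m = fps_nth (T ^ k) m" if "m \<le> n" for k m
    using that by (induction k arbitrary: m) (simp_all add: fps_mult_nth T)
  define F where "F = ({f. \<forall>i. f i \<in> {- int n..int n}} :: ('k \<Rightarrow> int) set)"
  have FP: "F = (UNIV :: 'k set) \<rightarrow>\<^sub>E {- int n..int n}" by (auto simp: F_def PiE_def)
  have "T ^ CARD('k) = (\<Prod>i\<in>(UNIV :: 'k set). \<Sum>x\<in>{- int n..int n}. fps_X ^ nat (x\<^sup>2))"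
    by (simp add: T_def)
  also have "\<dots> = (\<Sum>f\<in>F. \<Prod>i\<in>UNIV. fps_X ^ nat ((f i)\<^sup>2))"
    unfolding FP by (rule prod_sum_PiE) auto
  also have "\<dots> = (\<Sum>f\<in>F. fps_X ^ (\<Sum>i\<in>UNIV. nat ((f i)\<^sup>2)))"
    by (simp add: power_sum)
  finally have "fps_nth (T ^ CARD('k)) n = (\<Sum>f\<in>F. if n = (\<Sum>i\<in>UNIV. nat ((f i)\<^sup>2)) then 1 else 0)"
    by (simp add: fps_sum_nth)
  also have "\<dots> = real (card (F \<inter> {f. n = (\<Sum>i\<in>UNIV. nat ((f i)\<^sup>2))}))"
    by (subst sum.If_cases) (auto simp: FP intro!: finite_PiE)
  also have "card (F \<inter> {f. n = (\<Sum>i\<in>UNIV. nat ((f i)\<^sup>2))}) =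
      num_reps (\<lambda>x::int^'k. \<Sum>i\<in>UNIV. (x $ i)\<^sup>2) n"
    unfolding num_reps_def
  proof (rule bij_betw_same_card, rule bij_betw_byWitness[where f' = "vec_nth"])
    have *: "int (\<Sum>i\<in>UNIV. nat ((f i)\<^sup>2)) = (\<Sum>i\<in>UNIV. (f i)\<^sup>2)" for f :: "'k \<Rightarrow> int"
      by simp
    show "vec_lambda ` (F \<inter> {f. n = (\<Sum>i\<in>UNIV. nat ((f i)\<^sup>2))}) \<subseteq>
        {x :: int^'k. (\<Sum>i\<in>UNIV. (x $ i)\<^sup>2) = int n}"
      by auto
    show "vec_nth ` {x :: int^'k. (\<Sum>i\<in>UNIV. (x $ i)\<^sup>2) = int n} \<subseteq>
        F \<inter> {f. n = (\<Sum>i\<in>UNIV. nat ((f i)\<^sup>2))}"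
    proof clarify
      fix x :: "int^'k" assume x: "(\<Sum>i\<in>UNIV. (x $ i)\<^sup>2) = int n"
      have "x $ i \<in> {- int n..int n}" for i
        using member_le_sum[of i UNIV "\<lambda>i. (x $ i)\<^sup>2"] abs_le_square[of "x $ i"] x by auto
      moreover have "n = (\<Sum>i\<in>UNIV. nat ((x $ i)\<^sup>2))"
        using x *[of "vec_nth x"] by linarith
      ultimately show "vec_nth x \<in> F \<inter> {f. n = (\<Sum>i\<in>UNIV. nat ((f i)\<^sup>2))}"
        by (simp add: F_def)
    qed
  qed auto
  finally show ?thesis using pow[of n] by simp
qed

section \<open>Differential equations for the fourth powers of theta series\<close>

text \<open>
  In the classical notation, with nome \<open>q\<close>, these two series are the fourth powers of the theta
  constants \<open>\<theta>\<^sub>3\<close> and \<open>\<theta>\<^sub>4\<close>, and their difference is the fourth power of \<open>\<theta>\<^sub>2\<close>.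
\<close>
definition theta_a :: "real fps" where "theta_a = theta ^ 4"
definition theta_b :: "real fps" where "theta_b = alt theta ^ 4"

text \<open>
  Doubling replaces \<open>theta ^ 2\<close> and \<open>alt theta ^ 2\<close> by their arithmetic and geometric means.  The
  two duplication formulas are the squares of these statements.
\<close>
lemma dbl_theta_a: "4 * dbl theta_a = (theta ^ 2 + alt theta ^ 2) ^ 2"
proof -
  have "dbl theta_a = dbl (theta ^ 2) ^ 2" by (simp add: theta_a_def dbl_power)
  then show ?thesis by (simp add: theta_square_add)
qed

lemma dbl_theta_b: "dbl theta_b = theta ^ 2 * alt theta ^ 2"
proof -
  have "dbl theta_b = dbl (alt theta ^ 2) ^ 2" by (simp add: theta_b_def dbl_power)
  then show ?thesis by (simp add: power_mult_distrib flip: theta_mult_alt)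
qed

lemma theta_a_nth: "fps_nth theta_a 0 = 1" "fps_nth theta_a (Suc 0) = 8"
  using fps_power_first_eq[of theta 4]
  by (simp_all add: theta_a_def fps_nth_power_0 theta_nth_0 theta_nth_1)

lemma theta_b_nth: "fps_nth theta_b 0 = 1" "fps_nth theta_b (Suc 0) = - 8"
  using fps_power_first_eq[of "alt theta" 4]
  by (simp_all add: theta_b_def fps_nth_power_0 alt_nth theta_nth_0 theta_nth_1)

lemma theta_a_theta_b_nonzero: "theta_a \<noteq> 0" "theta_b \<noteq> 0" "theta_a - theta_b \<noteq> 0"
proof -
  show "theta_a \<noteq> 0" "theta_b \<noteq> 0" using theta_a_nth theta_b_nth by auto
  have "fps_nth (theta_a - theta_b) (Suc 0) \<noteq> 0" by (simp add: theta_a_nth theta_b_nth)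
  then show "theta_a - theta_b \<noteq> 0" by (metis fps_zero_nth)
qed

text \<open>
  The Wronskian on the left has at \<open>q = 0\<close> a zero at least as large as the product on the right,
  so it is a multiple \<open>t\<close> of it.  The duplication formulas show that doubling does not change
  \<open>t\<close>, so that \<open>t\<close> is constant.
\<close>
lemma theta_a_theta_b_wronskian: "fps_XD theta_a * theta_b - theta_a * fps_XD theta_b =
    theta_a * theta_b * (theta_a - theta_b)"
proof -
  define A B where "A = theta ^ 2" and "B = alt theta ^ 2"
  have a: "theta_a = A\<^sup>2" and b: "theta_b = B\<^sup>2"
    by (simp_all add: theta_a_def theta_b_def A_def B_def)
  have a2: "4 * dbl theta_a = (A + B)\<^sup>2" and b2: "dbl theta_b = A * B"
    by (simp_all add: dbl_theta_a dbl_theta_b A_def B_def)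
  define c where "c = theta_a - theta_b"
  define W where "W = fps_XD theta_a * theta_b - theta_a * fps_XD theta_b"
  define M where "M = theta_a * theta_b * c"
  have M0: "fps_nth M 0 = 0" and M1: "fps_nth M (Suc 0) = 16"
    by (simp_all add: M_def c_def theta_a_nth theta_b_nth fps_mult_nth)
  have W0: "fps_nth W 0 = 0" and W1: "fps_nth W (Suc 0) = 16"
    by (simp_all add: W_def theta_a_nth theta_b_nth fps_mult_nth)
  have "M dvd W"
  proof (subst fps_dvd_iff)
    show "M \<noteq> 0" "W \<noteq> 0" using M1 W1 by auto
    have "subdegree M \<le> 1" using M1 by (intro subdegree_leI) simp
    moreover have "subdegree W \<ge> 1" using W0 \<open>W \<noteq> 0\<close> by (intro subdegree_geI) auto
    ultimately show "subdegree M \<le> subdegree W" by simp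
  qed
  then obtain t where t: "W = M * t" by blast
  have M2: "16 * dbl M = A * B * c\<^sup>2"
  proof -
    have "16 * dbl M = (4 * dbl theta_a) * dbl theta_b * (4 * dbl theta_a - 4 * dbl theta_b)"
      by (simp add: M_def c_def dbl_mult dbl_diff algebra_simps)
    also have "\<dots> = A * B * c\<^sup>2"
      unfolding a2 b2 c_def unfolding a b by (simp add: power2_eq_square algebra_simps)
    finally show ?thesis .
  qed
  have "16 * A * B * dbl W = c * W"
  proof -
    have W: "W = 2 * A * B * (fps_XD A * B - A * fps_XD B)"
      unfolding W_def a b power2_eq_square fps_XD_mult by (simp add: algebra_simps)
    have "8 * dbl W = fps_XD (4 * dbl theta_a) * dbl theta_b
        - 4 * dbl theta_a * fps_XD (dbl theta_b)"
      by (simp add: W_def dbl_mult dbl_diff fps_XD_dbl fps_XD_mult algebra_simps)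
    also have "\<dots> = c * (fps_XD A * B - A * fps_XD B)"
      unfolding a2 b2 c_def unfolding a b power2_eq_square fps_XD_mult fps_XD_add
      by (simp add: algebra_simps)
    finally have "2 * A * B * (8 * dbl W) = 2 * A * B * (c * (fps_XD A * B - A * fps_XD B))"
      by simp
    then show ?thesis unfolding W by (simp add: algebra_simps)
  qed
  then have "A * B * dbl t * (16 * dbl M) = c * M * t"
    by (simp add: t dbl_mult algebra_simps)
  then have "(theta_a * theta_b * c * c) * dbl t = (theta_a * theta_b * c * c) * t"
    unfolding M2 by (simp add: M_def a b power2_eq_square algebra_simps)
  then have "t = dbl t"
    using theta_a_theta_b_nonzero by (simp add: c_def)
  then have "fps_nth t n = 0" if "n > 0" for n
    using dbl_eigen_nth_eq_0[of t 1 n] that by simp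
  moreover have "fps_nth t 0 = 1"
    using W1 unfolding t by (simp add: fps_mult_nth M0 M1)
  ultimately have "t = 1" by (simp add: fps_eq_iff)
  then show ?thesis using t by (simp add: W_def M_def c_def)
qed

text \<open>
  The logarithmic derivative of \<open>theta_a * theta_b ^ 4 * (theta_a - theta_b)\<close>, which will turn out
  to be the discriminant up to a constant.  The formula solves \<open>fps_XD_theta_b\<close> below for it.
\<close>
definition theta_P :: "real fps" where
  "theta_P = 6 * fps_XD theta_b * inverse theta_b + 2 * theta_a - theta_b"

lemma fps_XD_theta_b: "6 * fps_XD theta_b = theta_b * (theta_P - 2 * theta_a + theta_b)"
proof -
  have "inverse theta_b * theta_b = 1" by (rule inverse_mult_eq_1) (simp add: theta_b_nth)
  then have "6 * fps_XD theta_b * (inverse theta_b * theta_b) =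
      theta_b * (theta_P - 2 * theta_a + theta_b)"
    by (simp only: theta_P_def) (simp add: algebra_simps)
  with \<open>inverse theta_b * theta_b = 1\<close> show ?thesis by simp
qed

lemma fps_XD_theta_a: "6 * fps_XD theta_a = theta_a * (theta_P + 4 * theta_a - 5 * theta_b)"
proof -
  have "theta_b * (6 * fps_XD theta_a) = 6 * (fps_XD theta_a * theta_b
      - theta_a * fps_XD theta_b) + theta_a * (6 * fps_XD theta_b)"
    by (simp add: algebra_simps)
  also have "\<dots> = theta_b * (theta_a * (theta_P + 4 * theta_a - 5 * theta_b))"
    unfolding theta_a_theta_b_wronskian fps_XD_theta_b by (simp add: algebra_simps)
  finally show ?thesis using theta_a_theta_b_nonzero by simp
qed

lemma theta_P_nth: "fps_nth theta_P 0 = 1" "fps_nth theta_P (Suc 0) = - 24"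
proof -
  have [simp]: "fps_nth (inverse theta_b) 0 = 1" by (simp add: theta_b_nth)
  show "fps_nth theta_P 0 = 1" "fps_nth theta_P (Suc 0) = - 24"
    by (simp_all add: theta_P_def theta_a_nth theta_b_nth fps_mult_nth numeral_fps_const)
qed

text \<open>
  The square of \<open>dbl theta_b\<close> is \<open>theta_a * theta_b\<close>, so that its logarithmic derivative is known in
  two ways, once through \<open>dbl theta_P\<close> and once through \<open>theta_P\<close>.
\<close>
lemma dbl_theta_P: "2 * dbl theta_P = theta_P + 2 * theta_a - theta_b"
proof -
  define A B where "A = theta ^ 2" and "B = alt theta ^ 2"
  have a: "theta_a = A\<^sup>2" and b: "theta_b = B\<^sup>2"
    by (simp_all add: theta_a_def theta_b_def A_def B_def)
  have a2: "4 * dbl theta_a = (A + B)\<^sup>2" and b2: "dbl theta_b = A * B"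
    by (simp_all add: dbl_theta_a dbl_theta_b A_def B_def)
  have AB: "A * B \<noteq> 0" using theta_a_theta_b_nonzero by (auto simp: a b)
  have "2 * (A * B) * (6 * fps_XD (A * B)) =
      6 * fps_XD theta_a * theta_b + theta_a * (6 * fps_XD theta_b)"
    by (simp add: a b power2_eq_square fps_XD_mult algebra_simps)
  also have "\<dots> = 2 * (A * B) * (A * B * (theta_P + theta_a - 2 * theta_b))"
    unfolding fps_XD_theta_a fps_XD_theta_b by (simp add: a b power2_eq_square algebra_simps)
  finally have *: "2 * (A * B) * (6 * fps_XD (A * B)) =
      2 * (A * B) * (A * B * (theta_P + theta_a - 2 * theta_b))" .
  have D: "6 * fps_XD (A * B) = A * B * (theta_P + theta_a - 2 * theta_b)"
    by (rule mult_left_cancel[THEN iffD1, OF _ *]) (use AB in simp)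
  have "6 * fps_XD (A * B) = 2 * dbl (6 * fps_XD theta_b)"
    by (simp add: dbl_mult fps_XD_dbl flip: b2)
  also have "\<dots> = A * B * (2 * dbl theta_P - 4 * dbl theta_a + 2 * (A * B))"
    unfolding fps_XD_theta_b by (simp add: dbl_mult dbl_add dbl_diff b2 algebra_simps)
  finally have "2 * dbl theta_P - 4 * dbl theta_a + 2 * (A * B) = theta_P + theta_a - 2 * theta_b"
    using AB by (simp add: D)
  then have "2 * dbl theta_P = theta_P + theta_a - 2 * theta_b + (A + B)\<^sup>2 - 2 * (A * B)"
    unfolding a2 by (simp add: algebra_simps)
  then show ?thesis by (simp add: a b power2_eq_square algebra_simps)
qed

text \<open>
  The polynomials that express the Eisenstein series of weights 4 and 6 through theta constants.
  They are dictated by the differential equations \<open>fps_XD_theta_P\<close> and \<open>fps_XD_theta_Q\<close>.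
\<close>
definition theta_Q :: "real fps" where
  "theta_Q = 16 * theta_a ^ 2 - 16 * theta_a * theta_b + theta_b ^ 2"

definition theta_R :: "real fps" where
  "theta_R = 96 * theta_a ^ 2 * theta_b - 64 * theta_a ^ 3 - 30 * theta_a * theta_b ^ 2
      - theta_b ^ 3"

lemma dbl_theta_Q: "dbl theta_Q = theta_a ^ 2 - theta_a * theta_b + theta_b ^ 2"
proof -
  define A B where "A = theta ^ 2" and "B = alt theta ^ 2"
  have a: "theta_a = A\<^sup>2" and b: "theta_b = B\<^sup>2"
    by (simp_all add: theta_a_def theta_b_def A_def B_def)
  have a2: "4 * dbl theta_a = (A + B)\<^sup>2" and b2: "dbl theta_b = A * B"
    by (simp_all add: dbl_theta_a dbl_theta_b A_def B_def)
  have "dbl theta_Q = (4 * dbl theta_a) ^ 2 - 4 * (4 * dbl theta_a) * dbl theta_b + dbl theta_b ^ 2"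
    by (simp add: theta_Q_def dbl_simps power2_eq_square)
  also have "\<dots> = theta_a ^ 2 - theta_a * theta_b + theta_b ^ 2"
    unfolding a2 b2 unfolding a b by (simp add: power2_eq_square algebra_simps)
  finally show ?thesis .
qed

text \<open>
  With \<open>K\<close> the difference of the two sides, the duplication formulas give \<open>K = 4 dbl K\<close>, whose
  only solution is \<open>0\<close>.
\<close>
lemma fps_XD_theta_P: "12 * fps_XD theta_P = theta_P ^ 2 - theta_Q"
proof -
  define K where "K = theta_P ^ 2 - theta_Q - 12 * fps_XD theta_P"
  have "4 * dbl K = (2 * dbl theta_P) ^ 2 - 4 * dbl theta_Q - 12 * (2 * (2 * dbl (fps_XD theta_P)))"
    by (simp add: K_def dbl_simps power2_eq_square algebra_simps)
  also have "2 * (2 * dbl (fps_XD theta_P)) = fps_XD (theta_P + 2 * theta_a - theta_b)"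
    by (simp add: fps_XD_mult flip: fps_XD_dbl dbl_theta_P)
  also have "12 * \<dots> = 12 * fps_XD theta_P + 4 * (6 * fps_XD theta_a) - 2 * (6 * fps_XD theta_b)"
    by (simp add: fps_XD_add fps_XD_diff fps_XD_mult algebra_simps)
  also have "(2 * dbl theta_P) ^ 2 - 4 * dbl theta_Q - \<dots> = K"
    unfolding dbl_theta_P dbl_theta_Q fps_XD_theta_a fps_XD_theta_b unfolding K_def theta_Q_def
    by (simp add: power2_eq_square algebra_simps)
  finally have K: "K = fps_const 4 * dbl K" by (simp add: numeral_fps_const)
  have "fps_nth K n = 0" for n
  proof (cases "n = 0")
    case True
    then show ?thesis using arg_cong[OF K, of "\<lambda>f. fps_nth f 0"] by (simp add: dbl_nth)
  qed (use dbl_eigen_nth_eq_0[OF K] in simp)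
  then show ?thesis by (simp add: K_def fps_eq_iff)
qed

lemma fps_XD_theta_Q: "3 * fps_XD theta_Q = theta_P * theta_Q - theta_R"
proof -
  have "2 * (3 * fps_XD theta_Q) = 32 * theta_a * (6 * fps_XD theta_a) -
      16 * (6 * fps_XD theta_a * theta_b + theta_a * (6 * fps_XD theta_b))
          + 2 * theta_b * (6 * fps_XD theta_b)"
    by (simp add: theta_Q_def fps_XD_add fps_XD_diff fps_XD_mult power2_eq_square algebra_simps)
  also have "\<dots> = 2 * (theta_P * theta_Q - theta_R)"
    unfolding fps_XD_theta_a fps_XD_theta_b theta_Q_def theta_R_def
    by (simp add: power2_eq_square power3_eq_cube algebra_simps)
  finally show ?thesis by (rule mult_left_cancel[THEN iffD1, rotated]) simp
qed

lemma fps_XD_theta_R: "2 * fps_XD theta_R = theta_P * theta_R - theta_Q ^ 2"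
proof -
  have "3 * (2 * fps_XD theta_R) = 96 * (2 * theta_a * theta_b * (6 * fps_XD theta_a)
      + theta_a ^ 2 * (6 * fps_XD theta_b))
      - 64 * 3 * theta_a ^ 2 * (6 * fps_XD theta_a)
      - 30 * (6 * fps_XD theta_a * theta_b ^ 2 + 2 * theta_a * theta_b * (6 * fps_XD theta_b))
      - 3 * theta_b ^ 2 * (6 * fps_XD theta_b)"
    by (simp add: theta_R_def fps_XD_add fps_XD_diff fps_XD_mult power2_eq_square power3_eq_cube
        algebra_simps)
  also have "\<dots> = 3 * (theta_P * theta_R - theta_Q ^ 2)"
    unfolding fps_XD_theta_a fps_XD_theta_b theta_Q_def theta_R_def
    by (simp add: power2_eq_square power3_eq_cube algebra_simps)
  finally show ?thesis by (rule mult_left_cancel[THEN iffD1, rotated]) simp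
qed

section \<open>Convolutions of divisor sums\<close>

definition divisor_series :: "(nat \<Rightarrow> real) \<Rightarrow> real fps" where
  "divisor_series u = Abs_fps (\<lambda>n. if n = 0 then 0 else \<Sum>d | d dvd n. u d)"

text \<open>
  The solutions of \<open>a x + b y = n\<close> in positive integers index the terms in the \<open>n\<close>-th coefficient
  of a product of two Lambert series.
\<close>
definition quads :: "nat \<Rightarrow> (nat \<times> nat \<times> nat \<times> nat) set" where
  "quads n = {(a, b, x, y). 0 < a \<and> 0 < b \<and> 0 < x \<and> 0 < y \<and> a * x + b * y = n}"

lemma finite_quads [simp]: "finite (quads n)"
proof (rule finite_subset)
  have "a \<le> n \<and> b \<le> n \<and> x \<le> n \<and> y \<le> n"
    if "0 < a" "0 < b" "0 < x" "0 < y" "a * x + b * y = n" for a b x y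
  proof -
    have "a \<le> a * x" "x \<le> a * x" "b \<le> b * y" "y \<le> b * y" using that by auto
    then show ?thesis using that by linarith
  qed
  then show "quads n \<subseteq> {..n} \<times> {..n} \<times> {..n} \<times> {..n}"
    by (auto simp: quads_def)
qed simp

lemma dvd_div_pos: "d dvd n \<Longrightarrow> 0 < n \<Longrightarrow> 0 < n div (d::nat)"
  by (auto elim!: dvdE)

lemma divisor_series_mult_nth:
  "fps_nth (divisor_series u * divisor_series v) n = (\<Sum>(a, b, x, y)\<in>quads n. u a * v b)"
proof -
  have "fps_nth (divisor_series u * divisor_series v) n =
      (\<Sum>m\<in>{0<..<n}. (\<Sum>a | a dvd m. u a) * (\<Sum>b | b dvd (n - m). v b))"
    unfolding fps_mult_nth
    by (rule sum.mono_neutral_cong_right) (auto simp: divisor_series_def)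
  also have "\<dots> = (\<Sum>m\<in>{0<..<n}. \<Sum>(a, b)\<in>{a. a dvd m} \<times> {b. b dvd (n - m)}. u a * v b)"
    by (simp add: sum_product sum.cartesian_product)
  also have "\<dots> = (\<Sum>(m, a, b)\<in>(SIGMA m:{0<..<n}. {a. a dvd m} \<times> {b. b dvd (n - m)}). u a * v b)"
    by (subst sum.Sigma) auto
  also have "\<dots> = (\<Sum>(a, b, x, y)\<in>quads n. u a * v b)"
    by (rule sum.reindex_bij_witness[of _ "\<lambda>(a, b, x, y). (a * x, a, b)"
          "\<lambda>(m, a, b). (a, b, m div a, (n - m) div b)"])
      (auto simp: quads_def dvd_div_pos dvd_div_eq_0_iff intro!: Nat.gr0I)
  finally show ?thesis .
qed

lemma sum_trichotomy:
  fixes r s :: "'a \<Rightarrow> nat"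
  assumes "finite S"
  shows "sum h S = sum h {p \<in> S. r p > s p} + sum h {p \<in> S. r p < s p} + sum h {p \<in> S. r p = s p}"
proof -
  have "S = ({p \<in> S. r p > s p} \<union> {p \<in> S. r p < s p}) \<union> {p \<in> S. r p = s p}" by auto
  then have "sum h S = sum h (({p \<in> S. r p > s p} \<union> {p \<in> S. r p < s p}) \<union> {p \<in> S. r p = s p})"
    by simp
  also have "\<dots> = sum h {p \<in> S. r p > s p} + sum h {p \<in> S. r p < s p} + sum h {p \<in> S. r p = s p}"
    using assms by (subst sum.union_disjoint; auto)+
  finally show ?thesis .
qed

text \<open>
  The map \<open>(a, b, x, y) \<mapsto> (a - b, b, x, x + y)\<close> preserves \<open>a x + b y\<close> and carries the solutions
  with \<open>a > b\<close> to those with \<open>x < y\<close>, turning the summand \<open>g a b\<close> into \<open>g (a + b) b\<close>.  The two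
  symmetry assumptions say that both summands are unchanged when the two halves of a solution are
  exchanged, so each full sum is twice the sum over one half plus its diagonal, and only the
  diagonals \<open>a = b\<close> and \<open>x = y\<close> contribute to the difference.
\<close>
lemma quads_sum_identity:
  fixes g :: "nat \<Rightarrow> nat \<Rightarrow> real"
  assumes sym: "\<And>a b. g a b = g b a" and shift: "\<And>a b. g (a + b) b = g (a + b) a"
    and "n > 0"
  shows "(\<Sum>(a, b, x, y)\<in>quads n. g a b - g (a + b) b) =
    (\<Sum>d | d dvd n. (real (n div d) - 1) * g d d - (\<Sum>b\<in>{1..<d}. g d b))"
proof -
  let ?S = "quads n"
  define h1 h2 :: "nat \<times> nat \<times> nat \<times> nat \<Rightarrow> real"
    where "h1 = (\<lambda>(a, b, x, y). g a b)" and "h2 = (\<lambda>(a, b, x, y). g (a + b) b)"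
  define ra rb rx ry :: "nat \<times> nat \<times> nat \<times> nat \<Rightarrow> nat"
    where "ra = (\<lambda>(a, b, x, y). a)" and "rb = (\<lambda>(a, b, x, y). b)"
      and "rx = (\<lambda>(a, b, x, y). x)" and "ry = (\<lambda>(a, b, x, y). y)"
  note defs = h1_def h2_def ra_def rb_def rx_def ry_def quads_def
  have swap1: "sum h1 {p \<in> ?S. ra p < rb p} = sum h1 {p \<in> ?S. ra p > rb p}"
    by (rule sum.reindex_bij_witness[of _ "\<lambda>(a, b, x, y). (b, a, y, x)" "\<lambda>(a, b, x, y). (b, a, y, x)"])
      (auto simp: defs sym)
  have swap2: "sum h2 {p \<in> ?S. rx p > ry p} = sum h2 {p \<in> ?S. rx p < ry p}"
    by (rule sum.reindex_bij_witness[of _ "\<lambda>(a, b, x, y). (b, a, y, x)" "\<lambda>(a, b, x, y). (b, a, y, x)"])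
      (auto simp: defs shift add.commute)
  have main: "sum h1 {p \<in> ?S. ra p > rb p} = sum h2 {p \<in> ?S. rx p < ry p}"
  proof (rule sum.reindex_bij_witness[of _ "\<lambda>(a, b, x, y). (a + b, b, x, y - x)"
          "\<lambda>(a, b, x, y). (a - b, b, x, x + y)"])
    fix p assume "p \<in> {p \<in> ?S. ra p > rb p}"
    then obtain a b x y where p: "p = (a, b, x, y)" "b < a" "0 < b" "0 < x" "0 < y" "a * x
        + b * y = n"
      by (auto simp: defs)
    then obtain c where "a = b + c" "0 < c" using less_imp_add_positive by blast
    with p show "(case case p of (a, b, x, y) \<Rightarrow> (a - b, b, x, x + y) of
          (a, b, x, y) \<Rightarrow> (a + b, b, x, y - x)) = p"
      "(case p of (a, b, x, y) \<Rightarrow> (a - b, b, x, x + y)) \<in> {p \<in> ?S. rx p < ry p}"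
      "h2 (case p of (a, b, x, y) \<Rightarrow> (a - b, b, x, x + y)) = h1 p"
      by (auto simp: defs algebra_simps)
  next
    fix p assume "p \<in> {p \<in> ?S. rx p < ry p}"
    then obtain a b x y where p: "p = (a, b, x, y)" "x < y" "0 < a" "0 < b" "0 < x" "a * x
        + b * y = n"
      by (auto simp: defs)
    then obtain z where "y = x + z" "0 < z" using less_imp_add_positive by blast
    with p show "(case case p of (a, b, x, y) \<Rightarrow> (a + b, b, x, y - x) of
          (a, b, x, y) \<Rightarrow> (a - b, b, x, x + y)) = p"
      "(case p of (a, b, x, y) \<Rightarrow> (a + b, b, x, y - x)) \<in> {p \<in> ?S. ra p > rb p}"
      by (auto simp: defs algebra_simps)
  qed
  have diag1: "sum h1 {p \<in> ?S. ra p = rb p} = (\<Sum>d | d dvd n. (real (n div d) - 1) * g d d)"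
  proof -
    have "sum h1 {p \<in> ?S. ra p = rb p} =
        (\<Sum>(d, x)\<in>(SIGMA d:{d. d dvd n}. {1..<n div d}). g d d)"
    proof (rule sum.reindex_bij_witness[of _ "\<lambda>(d, x). (d, d, x, n div d - x)" "\<lambda>(a, b, x, y). (a, x)"])
      fix p assume "p \<in> {p \<in> ?S. ra p = rb p}"
      then obtain a x y where p: "p = (a, a, x, y)" "a > 0" "x > 0" "y > 0" "n = a * (x + y)"
        by (auto simp: defs algebra_simps)
      then have "n div a = x + y" by simp
      then show "(case case p of (a, b, x, y) \<Rightarrow> (a, x) of (d, x) \<Rightarrow> (d, d, x, n div d - x)) = p"
        "(case p of (a, b, x, y) \<Rightarrow> (a, x)) \<in> (SIGMA d:{d. d dvd n}. {1..<n div d})"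
        "(case case p of (a, b, x, y) \<Rightarrow> (a, x) of (d, x) \<Rightarrow> g d d) = h1 p"
        using p by (auto simp: defs)
    next
      fix q assume "q \<in> (SIGMA d:{d. d dvd n}. {1..<n div d})"
      then obtain d x where q: "q = (d, x)" "d dvd n" "1 \<le> x" "x < n div d" by auto
      then have d: "d > 0" "d * (n div d) = n" using \<open>n > 0\<close> by (auto simp: dvd_pos_nat)
      then have "d * x + d * (n div d - x) = n"
        using q(4) by (simp flip: add_mult_distrib2)
      then show "(case case q of (d, x) \<Rightarrow> (d, d, x, n div d - x) of (a, b, x, y) \<Rightarrow> (a, x)) = q"
        "(case q of (d, x) \<Rightarrow> (d, d, x, n div d - x)) \<in> {p \<in> ?S. ra p = rb p}"
        using q d by (auto simp: defs)
    qed
    also have "\<dots> = (\<Sum>d | d dvd n. \<Sum>x\<in>{1..<n div d}. g d d)"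
      using \<open>n > 0\<close> by (subst sum.Sigma) auto
    also have "\<dots> = (\<Sum>d | d dvd n. (real (n div d) - 1) * g d d)"
    proof (rule sum.cong)
      fix d assume "d \<in> {d. d dvd n}"
      then have "n div d \<ge> 1" using \<open>n > 0\<close> by (simp add: Suc_le_eq dvd_div_pos)
      then show "(\<Sum>x\<in>{1..<n div d}. g d d) = (real (n div d) - 1) * g d d"
        by (simp add: of_nat_diff)
    qed simp
    finally show ?thesis .
  qed
  have diag2: "sum h2 {p \<in> ?S. rx p = ry p} = (\<Sum>d | d dvd n. \<Sum>b\<in>{1..<d}. g d b)"
  proof -
    have "sum h2 {p \<in> ?S. rx p = ry p} =
        (\<Sum>(d, b)\<in>(SIGMA d:{d. d dvd n}. {1..<d}). g d b)"
    proof (rule sum.reindex_bij_witness[of _ "\<lambda>(d, b). (d - b, b, n div d, n div d)"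
          "\<lambda>(a, b, x, y). (a + b, b)"])
      fix p assume "p \<in> {p \<in> ?S. rx p = ry p}"
      then obtain a b x where p: "p = (a, b, x, x)" "a > 0" "b > 0" "x > 0" "n = (a + b) * x"
        by (auto simp: defs algebra_simps)
      then have "n div (a + b) = x" by simp
      then show "(case case p of (a, b, x, y) \<Rightarrow> (a + b, b) of (d, b) \<Rightarrow> (d - b, b, n div d, n div d)) = p"
        "(case p of (a, b, x, y) \<Rightarrow> (a + b, b)) \<in> (SIGMA d:{d. d dvd n}. {1..<d})"
        "(case case p of (a, b, x, y) \<Rightarrow> (a + b, b) of (d, b) \<Rightarrow> g d b) = h2 p"
        using p by (auto simp: defs)
    next
      fix q assume "q \<in> (SIGMA d:{d. d dvd n}. {1..<d})"
      then obtain d b where q: "q = (d, b)" "d dvd n" "1 \<le> b" "b < d" by auto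
      then have d: "n div d > 0" "d * (n div d) = n" using \<open>n > 0\<close> by (auto simp: dvd_div_pos)
      then have "(d - b) * (n div d) + b * (n div d) = n"
        using q(4) by (simp flip: add_mult_distrib)
      then show "(case case q of (d, b) \<Rightarrow> (d - b, b, n div d, n div d) of (a, b, x, y) \<Rightarrow> (a + b, b)) = q"
        "(case q of (d, b) \<Rightarrow> (d - b, b, n div d, n div d)) \<in> {p \<in> ?S. rx p = ry p}"
        using q d by (auto simp: defs)
    qed
    also have "\<dots> = (\<Sum>d | d dvd n. \<Sum>b\<in>{1..<d}. g d b)"
      using \<open>n > 0\<close> by (subst sum.Sigma) auto
    finally show ?thesis .
  qed
  have "(\<Sum>(a, b, x, y)\<in>?S. g a b - g (a + b) b) = sum h1 ?S - sum h2 ?S"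
    by (simp add: h1_def h2_def case_prod_unfold sum_subtractf)
  also have "\<dots> = sum h1 {p \<in> ?S. ra p = rb p} - sum h2 {p \<in> ?S. rx p = ry p}"
    using sum_trichotomy[of ?S h1 rb ra] sum_trichotomy[of ?S h2 ry rx] swap1 swap2 main by simp
  finally show ?thesis unfolding diag1 diag2 by (simp add: sum_subtractf)
qed

lemma sum_powers:
  shows "(\<Sum>b<d. real b) = real d ^ 2 / 2 - real d / 2"
    and "(\<Sum>b<d. real b ^ 2) = real d ^ 3 / 3 - real d ^ 2 / 2 + real d / 6"
    and "(\<Sum>b<d. real b ^ 3) = real d ^ 4 / 4 - real d ^ 3 / 2 + real d ^ 2 / 4"
    and "(\<Sum>b<d. real b ^ 4) = real d ^ 5 / 5 - real d ^ 4 / 2 + real d ^ 3 / 3 - real d / 30"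
    and "(\<Sum>b<d. real b ^ 5) =
      real d ^ 6 / 6 - real d ^ 5 / 2 + 5 * real d ^ 4 / 12 - real d ^ 2 / 12"
    and "(\<Sum>b<d. real b ^ 6) =
      real d ^ 7 / 7 - real d ^ 6 / 2 + real d ^ 5 / 2 - real d ^ 3 / 6 + real d / 42"
    and "(\<Sum>b<d. real b ^ 7) =
      real d ^ 8 / 8 - real d ^ 7 / 2 + 7 * real d ^ 6 / 12 - 7 * real d ^ 4 / 24 + real d ^ 2 / 12"
    and "(\<Sum>b<d. real b ^ 8) =
      real d ^ 9 / 9 - real d ^ 8 / 2 + 2 * real d ^ 7 / 3 - 7 * real d ^ 5 / 15 +
      2 * real d ^ 3 / 9 - real d / 30"
  by (induction d) (simp_all add: field_simps eval_nat_numeral)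

text \<open>
  These generate the polynomials that are symmetric and invariant under
  \<open>(u, v) \<mapsto> (u, u - v)\<close>, which is what \<open>quads_sum_identity\<close> asks of \<open>g\<close>.  The two symmetries
  generate a dihedral group of order 12, whose basic invariants have the degrees 2 and 6.
\<close>
definition quad2 :: "real \<Rightarrow> real \<Rightarrow> real" where
  "quad2 u v = u\<^sup>2 - u * v + v\<^sup>2"

definition disc6 :: "real \<Rightarrow> real \<Rightarrow> real" where
  "disc6 u v = (u * v * (u - v))\<^sup>2"

lemma quad2_sym: "quad2 u v = quad2 v u"
  by (simp add: quad2_def algebra_simps)

lemma disc6_sym: "disc6 u v = disc6 v u"
  by (simp add: disc6_def power2_eq_square algebra_simps)

lemma quad2_shift: "quad2 (u + v) v = u\<^sup>2 + u * v + v\<^sup>2"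
  by (simp add: quad2_def power2_eq_square algebra_simps)

lemma disc6_shift: "disc6 (u + v) v = (u * v * (u + v))\<^sup>2"
  by (simp add: disc6_def power2_eq_square algebra_simps)

definition sig :: "nat \<Rightarrow> real fps" where
  "sig k = divisor_series (\<lambda>d. real d ^ k)"

lemma sig_nth: "fps_nth (sig k) n = (if n = 0 then 0 else \<Sum>d | d dvd n. real d ^ k)"
  by (simp add: sig_def divisor_series_def)

lemma sig_mult_nth: "fps_nth (sig j * sig k) n = (\<Sum>(a, b, x, y)\<in>quads n. real a ^ j * real b ^ k)"
  by (simp add: sig_def divisor_series_mult_nth)

lemma sum_sum_list_swap:
  "(\<Sum>x\<in>A. \<Sum>y\<leftarrow>ys. h x y) = (\<Sum>y\<leftarrow>ys. \<Sum>x\<in>A. (h x y :: real))"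
  by (induction ys) (simp_all add: sum.distrib)

text \<open>
  For \<open>g = f (quad2, disc6)\<close> the value at \<open>(u + v, v)\<close> is the value at \<open>(u, - v)\<close>.  As \<open>g\<close> has
  only terms of even degree, the difference in \<open>quads_sum_identity\<close> therefore retains exactly the
  monomials with two odd exponents, and these sum to convolutions of divisor sums.  The boundary
  terms are polynomials in the divisor \<open>d\<close> by summation of powers, apart from \<open>(n / d) g(d, d)\<close>,
  which is \<open>n\<close> times a power of \<open>d\<close> and so gives a derivative.
\<close>
lemma sig_relation:
  fixes f :: "real \<Rightarrow> real \<Rightarrow> real" and ps :: "(real \<times> nat \<times> nat) list"
    and rs :: "(real \<times> nat) list"
  defines "g \<equiv> \<lambda>u v. f (quad2 u v) (disc6 u v)"
  assumes odd_part: "\<And>u v. g u v - g (u + v) v = (\<Sum>(c, i, j)\<leftarrow>ps. c * (u ^ i * v ^ j))"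
    and boundary: "\<And>m d. (real m - 1) * g d d - (\<Sum>b<d. g d b) + g d 0 =
      \<alpha> * (real (m * d) * real d ^ e) + (\<Sum>(c, k)\<leftarrow>rs. c * real d ^ k)"
  shows "(\<Sum>(c, i, j)\<leftarrow>ps. c * fps_nth (sig i * sig j) n) =
    \<alpha> * fps_nth (fps_XD (sig e)) n + (\<Sum>(c, k)\<leftarrow>rs. c * fps_nth (sig k) n)" (is "?L = ?R")
proof (cases "n = 0")
  case True
  then show ?thesis by (simp add: sig_nth case_prod_unfold)
next
  case False
  have "?L =
      (\<Sum>(c, i, j)\<leftarrow>ps. \<Sum>(a, b, x, y)\<in>quads n. c * (real a ^ i * real b ^ j))"
    by (simp add: sig_mult_nth sum_distrib_left case_prod_unfold)
  also have "\<dots> = (\<Sum>(a, b, x, y)\<in>quads n. g (real a) (real b) - g (real (a + b)) (real b))"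
    by (simp add: odd_part sum_sum_list_swap case_prod_unfold)
  also have "\<dots> = (\<Sum>d | d dvd n. (real (n div d) - 1) * g (real d) (real d) -
      (\<Sum>b\<in>{1..<d}. g (real d) (real b)))"
  proof (rule quads_sum_identity[of "\<lambda>a b. g (real a) (real b)"])
    fix a b :: nat
    show "g (real a) (real b) = g (real b) (real a)"
      by (simp add: g_def quad2_sym disc6_sym)
    have "quad2 (real (a + b)) (real b) = quad2 (real (a + b)) (real a)"
      "disc6 (real (a + b)) (real b) = disc6 (real (a + b)) (real a)"
      by (simp_all add: quad2_def disc6_def power2_eq_square algebra_simps)
    then show "g (real (a + b)) (real b) = g (real (a + b)) (real a)"
      by (simp only: g_def)
  qed (use False in simp)
  also have "\<dots> = (\<Sum>d | d dvd n. \<alpha> * (real n * real d ^ e) + (\<Sum>(c, k)\<leftarrow>rs. c * real d ^ k))"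
  proof (rule sum.cong)
    fix d assume "d \<in> {d. d dvd n}"
    then have d: "d > 0" "n div d * d = n" using False by (auto intro: Nat.gr0I)
    then have "{..<d} = insert 0 {1..<d}" by auto
    then have "(\<Sum>b<d. g (real d) (real b)) = g (real d) 0 + (\<Sum>b\<in>{1..<d}. g (real d) (real b))"
      by simp
    with boundary[of "n div d" d] d
    show "(real (n div d) - 1) * g (real d) (real d) - (\<Sum>b\<in>{1..<d}. g (real d) (real b)) =
        \<alpha> * (real n * real d ^ e) + (\<Sum>(c, k)\<leftarrow>rs. c * real d ^ k)"
      by simp
  qed simp
  also have "\<dots> = ?R"
    using False by (simp add: sig_nth sum_distrib_left sum.distrib
        sum_sum_list_swap case_prod_unfold)
  finally show ?thesis .
qed

lemma sig_1_1: "12 * sig 1 ^ 2 = 5 * sig 3 + sig 1 - 6 * fps_XD (sig 1)"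
proof -
  let ?ps = "[(-2, 1, 1)] :: (real \<times> nat \<times> nat) list"
  let ?rs = "[(- 5 / 6, 3), (- 1 / 6, 1)] :: (real \<times> nat) list"
  have rel: "(\<Sum>(c, i, j)\<leftarrow>?ps. c * fps_nth (sig i * sig j) n) =
      1 * fps_nth (fps_XD (sig 1)) n + (\<Sum>(c, k)\<leftarrow>?rs. c * fps_nth (sig k) n)" for n
  proof (rule sig_relation[where f = "\<lambda>t w. t"])
    fix u v :: real
    show "quad2 u v - quad2 (u + v) v =
        (\<Sum>(c, i, j)\<leftarrow>?ps. c * (u ^ i * v ^ j))"
      unfolding quad2_shift disc6_shift
      by (simp add: quad2_def disc6_def algebra_simps eval_nat_numeral)
  next
    fix m d :: nat
    have "quad2 d b = real d ^ 2 - real d * b + b ^ 2" for b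
      by (simp add: quad2_def disc6_def algebra_simps eval_nat_numeral)
    then have "(\<Sum>b<d. quad2 d b) = real d ^ 3 - real d * (\<Sum>b<d. real b) + (\<Sum>b<d. real b ^ 2)"
      by (simp add: sum.distrib sum_subtractf sum_distrib_left mult.assoc eval_nat_numeral)
    note S = this[unfolded sum_powers]
    show "(real m - 1) * (quad2 d d) - (\<Sum>b<d. quad2 d b) + quad2 d 0 =
        1 * (real (m * d) * real d ^ 1) + (\<Sum>(c, k)\<leftarrow>?rs. c * real d ^ k)"
      unfolding S by (simp add: quad2_def disc6_def field_simps eval_nat_numeral)
  qed
  show ?thesis
  proof (rule fps_ext)
    fix n
    from rel[of n]
    show "fps_nth (12 * sig 1 ^ 2) n =
        fps_nth (5 * sig 3 + sig 1 - 6 * fps_XD (sig 1)) n"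
      by (simp add: numeral_fps_const power2_eq_square)
  qed
qed

lemma sig_1_3: "240 * (sig 1 * sig 3) = 21 * sig 5 + 10 * sig 3 - sig 1 - 30 * fps_XD (sig 3)"
proof -
  let ?ps = "[(-4, 1, 3), (-4, 3, 1)] :: (real \<times> nat \<times> nat) list"
  let ?rs = "[(- 7 / 10, 5), (- 1 / 3, 3), (1 / 30, 1)] :: (real \<times> nat) list"
  have rel: "(\<Sum>(c, i, j)\<leftarrow>?ps. c * fps_nth (sig i * sig j) n) =
      1 * fps_nth (fps_XD (sig 3)) n + (\<Sum>(c, k)\<leftarrow>?rs. c * fps_nth (sig k) n)" for n
  proof (rule sig_relation[where f = "\<lambda>t w. t ^ 2"])
    fix u v :: real
    show "quad2 u v ^ 2 - quad2 (u + v) v ^ 2 =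
        (\<Sum>(c, i, j)\<leftarrow>?ps. c * (u ^ i * v ^ j))"
      unfolding quad2_shift disc6_shift
      by (simp add: quad2_def disc6_def algebra_simps eval_nat_numeral)
  next
    fix m d :: nat
    have "quad2 d b ^ 2 = real d ^ 4 - 2 * real d ^ 3 * b + 3 * real d ^ 2 * b ^ 2
        - 2 * real d * b ^ 3 + b ^ 4" for b
      by (simp add: quad2_def disc6_def algebra_simps eval_nat_numeral)
    then have "(\<Sum>b<d. quad2 d b ^ 2) = real d ^ 5 - 2 * real d ^ 3 * (\<Sum>b<d. real b)
        + 3 * real d ^ 2 * (\<Sum>b<d. real b ^ 2) - 2 * real d * (\<Sum>b<d. real b ^ 3)
        + (\<Sum>b<d. real b ^ 4)"
      by (simp add: sum.distrib sum_subtractf sum_distrib_left mult.assoc eval_nat_numeral)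
    note S = this[unfolded sum_powers]
    show "(real m - 1) * (quad2 d d ^ 2) - (\<Sum>b<d. quad2 d b ^ 2) + quad2 d 0 ^ 2 =
        1 * (real (m * d) * real d ^ 3) + (\<Sum>(c, k)\<leftarrow>?rs. c * real d ^ k)"
      unfolding S by (simp add: quad2_def disc6_def field_simps eval_nat_numeral)
  qed
  show ?thesis
  proof (rule fps_ext)
    fix n
    have "fps_nth (sig 3 * sig 1) n = fps_nth (sig 1 * sig 3) n" by (simp only: mult.commute)
    with rel[of n]
    show "fps_nth (240 * (sig 1 * sig 3)) n =
        fps_nth (21 * sig 5 + 10 * sig 3 - sig 1 - 30 * fps_XD (sig 3)) n"
      by (simp add: numeral_fps_const power2_eq_square)
  qed
qed

lemma sig_1_5: "5040 * (sig 1 * sig 5) + 5880 * sig 3 ^ 2 =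
    249 * sig 7 + 210 * sig 5 - 49 * sig 3 + 10 * sig 1 - 420 * fps_XD (sig 5)"
proof -
  let ?ps = "[(-6, 1, 5), (-6, 5, 1), (-14, 3, 3)] :: (real \<times> nat \<times> nat) list"
  let ?rs = "[(- 83 / 140, 7), (- 1 / 2, 5), (7 / 60, 3), (- 1 / 42, 1)] :: (real \<times> nat) list"
  have rel: "(\<Sum>(c, i, j)\<leftarrow>?ps. c * fps_nth (sig i * sig j) n) =
      1 * fps_nth (fps_XD (sig 5)) n + (\<Sum>(c, k)\<leftarrow>?rs. c * fps_nth (sig k) n)" for n
  proof (rule sig_relation[where f = "\<lambda>t w. t ^ 3"])
    fix u v :: real
    show "quad2 u v ^ 3 - quad2 (u + v) v ^ 3 =
        (\<Sum>(c, i, j)\<leftarrow>?ps. c * (u ^ i * v ^ j))"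
      unfolding quad2_shift disc6_shift
      by (simp add: quad2_def disc6_def algebra_simps eval_nat_numeral)
  next
    fix m d :: nat
    have "quad2 d b ^ 3 = real d ^ 6 - 3 * real d ^ 5 * b + 6 * real d ^ 4 * b ^ 2
        - 7 * real d ^ 3 * b ^ 3 + 6 * real d ^ 2 * b ^ 4 - 3 * real d * b ^ 5 + b ^ 6" for b
      by (simp add: quad2_def disc6_def algebra_simps eval_nat_numeral)
    then have "(\<Sum>b<d. quad2 d b ^ 3) = real d ^ 7 - 3 * real d ^ 5 * (\<Sum>b<d. real b)
        + 6 * real d ^ 4 * (\<Sum>b<d. real b ^ 2) - 7 * real d ^ 3 * (\<Sum>b<d. real b ^ 3)
        + 6 * real d ^ 2 * (\<Sum>b<d. real b ^ 4) - 3 * real d * (\<Sum>b<d. real b ^ 5)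
        + (\<Sum>b<d. real b ^ 6)"
      by (simp add: sum.distrib sum_subtractf sum_distrib_left mult.assoc eval_nat_numeral)
    note S = this[unfolded sum_powers]
    show "(real m - 1) * (quad2 d d ^ 3) - (\<Sum>b<d. quad2 d b ^ 3) + quad2 d 0 ^ 3 =
        1 * (real (m * d) * real d ^ 5) + (\<Sum>(c, k)\<leftarrow>?rs. c * real d ^ k)"
      unfolding S by (simp add: quad2_def disc6_def field_simps eval_nat_numeral)
  qed
  show ?thesis
  proof (rule fps_ext)
    fix n
    have "fps_nth (sig 5 * sig 1) n = fps_nth (sig 1 * sig 5) n" by (simp only: mult.commute)
    with rel[of n]
    show "fps_nth (5040 * (sig 1 * sig 5) + 5880 * sig 3 ^ 2) n =
        fps_nth (249 * sig 7 + 210 * sig 5 - 49 * sig 3 + 10 * sig 1 - 420 * fps_XD (sig 5)) n"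
      by (simp add: numeral_fps_const power2_eq_square)
  qed
qed

text \<open>
  In the next two relations the factor \<open>disc6\<close> removes all terms with a first power of \<open>a\<close> or
  \<open>b\<close>, and with them \<open>sig 1\<close>, and it vanishes for \<open>a = b\<close>, which removes the derivative.
  What remains are relations between genuine modular forms, of weights 8 and 12.
\<close>
lemma sig_3_3: "120 * sig 3 ^ 2 = sig 7 - sig 3"
proof -
  let ?ps = "[(-4, 3, 3)] :: (real \<times> nat \<times> nat) list"
  let ?rs = "[(- 1 / 30, 7), (1 / 30, 3)] :: (real \<times> nat) list"
  have rel: "(\<Sum>(c, i, j)\<leftarrow>?ps. c * fps_nth (sig i * sig j) n) =
      0 * fps_nth (fps_XD (sig 0)) n + (\<Sum>(c, k)\<leftarrow>?rs. c * fps_nth (sig k) n)" for n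
  proof (rule sig_relation[where f = "\<lambda>t w. w"])
    fix u v :: real
    show "disc6 u v - disc6 (u + v) v =
        (\<Sum>(c, i, j)\<leftarrow>?ps. c * (u ^ i * v ^ j))"
      unfolding quad2_shift disc6_shift
      by (simp add: quad2_def disc6_def algebra_simps eval_nat_numeral)
  next
    fix m d :: nat
    have "disc6 d b = real d ^ 4 * b ^ 2 - 2 * real d ^ 3 * b ^ 3 + real d ^ 2 * b ^ 4" for b
      by (simp add: quad2_def disc6_def algebra_simps eval_nat_numeral)
    then have "(\<Sum>b<d. disc6 d b) = real d ^ 4 * (\<Sum>b<d. real b ^ 2)
        - 2 * real d ^ 3 * (\<Sum>b<d. real b ^ 3) + real d ^ 2 * (\<Sum>b<d. real b ^ 4)"
      by (simp add: sum.distrib sum_subtractf sum_distrib_left mult.assoc eval_nat_numeral)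
    note S = this[unfolded sum_powers]
    show "(real m - 1) * (disc6 d d) - (\<Sum>b<d. disc6 d b) + disc6 d 0 =
        0 * (real (m * d) * real d ^ 0) + (\<Sum>(c, k)\<leftarrow>?rs. c * real d ^ k)"
      unfolding S by (simp add: quad2_def disc6_def field_simps eval_nat_numeral)
  qed
  show ?thesis
  proof (rule fps_ext)
    fix n
    from rel[of n]
    show "fps_nth (120 * sig 3 ^ 2) n =
        fps_nth (sig 7 - sig 3) n"
      by (simp add: numeral_fps_const power2_eq_square)
  qed
qed

lemma sig_3_7: "10080 * (sig 3 * sig 7) + 12600 * sig 5 ^ 2 =
    13 * sig 11 - 42 * sig 7 + 50 * sig 5 - 21 * sig 3"
proof -
  let ?ps = "[(-8, 3, 7), (-8, 7, 3), (-20, 5, 5)] :: (real \<times> nat \<times> nat) list"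
  let ?rs = "[(- 13 / 630, 11), (1 / 15, 7), (- 5 / 63, 5), (1 / 30, 3)] :: (real \<times> nat) list"
  have rel: "(\<Sum>(c, i, j)\<leftarrow>?ps. c * fps_nth (sig i * sig j) n) =
      0 * fps_nth (fps_XD (sig 0)) n + (\<Sum>(c, k)\<leftarrow>?rs. c * fps_nth (sig k) n)" for n
  proof (rule sig_relation[where f = "\<lambda>t w. t ^ 2 * w"])
    fix u v :: real
    show "quad2 u v ^ 2 * disc6 u v - quad2 (u + v) v ^ 2 * disc6 (u + v) v =
        (\<Sum>(c, i, j)\<leftarrow>?ps. c * (u ^ i * v ^ j))"
      unfolding quad2_shift disc6_shift
      by (simp add: quad2_def disc6_def algebra_simps eval_nat_numeral)
  next
    fix m d :: nat
    have "quad2 d b ^ 2 * disc6 d b = real d ^ 8 * b ^ 2 - 4 * real d ^ 7 * b ^ 3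
        + 8 * real d ^ 6 * b ^ 4 - 10 * real d ^ 5 * b ^ 5 + 8 * real d ^ 4 * b ^ 6
        - 4 * real d ^ 3 * b ^ 7 + real d ^ 2 * b ^ 8" for b
      by (simp add: quad2_def disc6_def algebra_simps eval_nat_numeral)
    then have "(\<Sum>b<d. quad2 d b ^ 2 * disc6 d b) =
        real d ^ 8 * (\<Sum>b<d. real b ^ 2) - 4 * real d ^ 7 * (\<Sum>b<d. real b ^ 3)
        + 8 * real d ^ 6 * (\<Sum>b<d. real b ^ 4) - 10 * real d ^ 5 * (\<Sum>b<d. real b ^ 5)
        + 8 * real d ^ 4 * (\<Sum>b<d. real b ^ 6) - 4 * real d ^ 3 * (\<Sum>b<d. real b ^ 7)
        + real d ^ 2 * (\<Sum>b<d. real b ^ 8)"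
      by (simp add: sum.distrib sum_subtractf sum_distrib_left mult.assoc eval_nat_numeral)
    note S = this[unfolded sum_powers]
    show "(real m - 1) * (quad2 d d ^ 2 * disc6 d d) - (\<Sum>b<d. quad2 d b ^ 2 * disc6 d b)
        + quad2 d 0 ^ 2 * disc6 d 0 =
        0 * (real (m * d) * real d ^ 0) + (\<Sum>(c, k)\<leftarrow>?rs. c * real d ^ k)"
      unfolding S by (simp add: quad2_def disc6_def field_simps eval_nat_numeral)
  qed
  show ?thesis
  proof (rule fps_ext)
    fix n
    have "fps_nth (sig 7 * sig 3) n = fps_nth (sig 3 * sig 7) n" by (simp only: mult.commute)
    with rel[of n]
    show "fps_nth (10080 * (sig 3 * sig 7) + 12600 * sig 5 ^ 2) n =
        fps_nth (13 * sig 11 - 42 * sig 7 + 50 * sig 5 - 21 * sig 3) n"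
      by (simp add: numeral_fps_const power2_eq_square)
  qed
qed

section \<open>Eisenstein series\<close>

text \<open>
  Ramanujan's \<open>P\<close>, \<open>Q\<close> and \<open>R\<close>, the normalised Eisenstein series of weights 2, 4 and 6.
\<close>
definition eisP :: "real fps" where "eisP = 1 - 24 * sig 1"
definition eisQ :: "real fps" where "eisQ = 1 + 240 * sig 3"
definition eisR :: "real fps" where "eisR = 1 - 504 * sig 5"

lemma fps_XD_1 [simp]: "fps_XD 1 = 0"
  by (simp add: fps_XD_def)

lemma fps_XD_eisP: "12 * fps_XD eisP = eisP ^ 2 - eisQ"
proof -
  have "eisP ^ 2 - eisQ = 48 * (12 * sig 1 ^ 2) - 48 * sig 1 - 240 * sig 3"
    by (simp add: eisP_def eisQ_def power2_eq_square algebra_simps)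
  also have "\<dots> = 12 * fps_XD eisP"
    unfolding sig_1_1 by (simp add: eisP_def fps_XD_diff fps_XD_mult algebra_simps)
  finally show ?thesis by simp
qed

lemma fps_XD_eisQ: "3 * fps_XD eisQ = eisP * eisQ - eisR"
proof -
  have "eisP * eisQ - eisR = 240 * sig 3 - 24 * sig 1 + 504 * sig 5 - 24 * (240 * (sig 1 * sig 3))"
    by (simp add: eisP_def eisQ_def eisR_def algebra_simps)
  also have "\<dots> = 3 * fps_XD eisQ"
    unfolding sig_1_3 by (simp add: eisQ_def fps_XD_add fps_XD_mult algebra_simps)
  finally show ?thesis by simp
qed

lemma eisQ_square: "eisQ ^ 2 = 1 + 480 * sig 7"
proof -
  have "eisQ ^ 2 = 1 + 480 * sig 3 + 480 * (120 * sig 3 ^ 2)"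
    by (simp add: eisQ_def power2_eq_square algebra_simps)
  also have "\<dots> = 1 + 480 * sig 7"
    unfolding sig_3_3 by (simp add: algebra_simps)
  finally show ?thesis .
qed

lemma fps_XD_eisR: "2 * fps_XD eisR = eisP * eisR - eisQ ^ 2"
proof -
  have "5 * (eisP * eisR - eisQ ^ 2) = 12 * (5040 * (sig 1 * sig 5) + 5880 * sig 3 ^ 2)
      - 588 * (120 * sig 3 ^ 2) - 120 * sig 1 - 2520 * sig 5 - 2400 * sig 7"
    unfolding eisQ_square by (simp add: eisP_def eisR_def power2_eq_square algebra_simps)
  also have "\<dots> = 5 * (2 * fps_XD eisR)"
    unfolding sig_1_5 unfolding sig_3_3
      by (simp add: eisR_def fps_XD_diff fps_XD_mult algebra_simps)
  finally have *: "5 * (2 * fps_XD eisR) = 5 * (eisP * eisR - eisQ ^ 2)" ..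
  show ?thesis by (rule mult_left_cancel[THEN iffD1, OF _ *]) simp
qed

text \<open>
  The space of modular forms of weight 12 contains a cusp form, so \<open>E\<^sub>1\<^sub>2\<close> is not a
  single product of Eisenstein series.  The relation \<open>sig_3_7\<close> fixes the combination of
  \<open>E\<^sub>4 E\<^sub>8\<close> and \<open>E\<^sub>6\<^sup>2\<close> in which the cusp form cancels.
\<close>
lemma eisenstein_12: "691 + 65520 * sig 11 = 441 * eisQ ^ 3 + 250 * eisR ^ 2"
proof -
  have "441 * eisQ ^ 3 + 250 * eisR ^ 2 = 441 * (eisQ * eisQ ^ 2) + 250 * eisR ^ 2"
    by (simp add: power3_eq_cube power2_eq_square)
  also have "\<dots> = 691 + 441 * 240 * sig 3 + 441 * 480 * sig 7 - 250 * 1008 * sig 5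
      + 5040 * (10080 * (sig 3 * sig 7) + 12600 * sig 5 ^ 2)"
    unfolding eisQ_square by (simp add: eisQ_def eisR_def power2_eq_square algebra_simps)
  also have "\<dots> = 691 + 65520 * sig 11"
    unfolding sig_3_7 by (simp add: algebra_simps)
  finally show ?thesis by simp
qed

lemma fps_mult_nth_ends:
  fixes f g :: "'a::comm_semiring_1 fps"
  assumes "n > 0"
  shows "fps_nth (f * g) n =
    fps_nth f 0 * fps_nth g n + fps_nth f n * fps_nth g 0
        + (\<Sum>i\<in>{1..<n}. fps_nth f i * fps_nth g (n - i))"
proof -
  have "{0..n} = insert 0 (insert n {1..<n})" using assms by auto
  then show ?thesis using assms by (simp add: fps_mult_nth add.assoc)
qed

text \<open>
  Comparing coefficients of \<open>q\<^sup>n\<close> gives a linear system of determinant \<open>72 n\<^sup>2 (n - 1)\<close> for the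
  \<open>n\<close>-th coefficients of the three series, which explains the separate condition at \<open>n = 1\<close>.
\<close>
lemma ramanujan_system_unique:
  fixes P Q R P' Q' R' :: "real fps"
  assumes eqs: "12 * fps_XD P = P ^ 2 - Q" "3 * fps_XD Q = P * Q - R" "2 * fps_XD R = P * R - Q ^ 2"
    and eqs': "12 * fps_XD P' = P' ^ 2 - Q'" "3 * fps_XD Q' = P' * Q' - R'"
      "2 * fps_XD R' = P' * R' - Q' ^ 2"
    and init: "fps_nth P 0 = 1" "fps_nth Q 0 = 1" "fps_nth R 0 = 1"
    and init': "fps_nth P' 0 = 1" "fps_nth Q' 0 = 1" "fps_nth R' 0 = 1"
    and first: "fps_nth P 1 = fps_nth P' 1"
  shows "P = P' \<and> Q = Q' \<and> R = R'"
proof -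
  have "fps_nth P n = fps_nth P' n \<and> fps_nth Q n = fps_nth Q' n \<and> fps_nth R n = fps_nth R' n" for n
  proof (induction n rule: less_induct)
    case (less n)
    show ?case
    proof (cases "n = 0")
      case False
      then have n: "n > 0" by simp
      define x y z where "x = fps_nth P n - fps_nth P' n" and "y = fps_nth Q n - fps_nth Q' n"
        and "z = fps_nth R n - fps_nth R' n"
      have mid: "(\<Sum>i\<in>{1..<n}. fps_nth f i * fps_nth g (n - i)) =
          (\<Sum>i\<in>{1..<n}. fps_nth f' i * fps_nth g' (n - i))"
        if "\<And>i. i < n \<Longrightarrow> fps_nth f i = fps_nth f' i" "\<And>i. i < n \<Longrightarrow> fps_nth g i = fps_nth g' i"
        for f g f' g' :: "real fps"
        by (rule sum.cong) (use that in auto)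
      note nth = numeral_fps_const power2_eq_square fps_mult_nth_ends[OF n]
      have "12 * real n * x = 2 * x - y"
        using arg_cong[OF eqs(1), of "\<lambda>f. fps_nth f n"] arg_cong[OF eqs'(1), of "\<lambda>f. fps_nth f n"]
          mid[of P P' P P'] less.IH
        by (simp add: nth init init' x_def y_def algebra_simps)
      moreover have "3 * real n * y = x + y - z"
        using arg_cong[OF eqs(2), of "\<lambda>f. fps_nth f n"] arg_cong[OF eqs'(2), of "\<lambda>f. fps_nth f n"]
          mid[of P P' Q Q'] less.IH
        by (simp add: nth init init' x_def y_def z_def algebra_simps)
      moreover have "2 * real n * z = x + z - 2 * y"
        using arg_cong[OF eqs(3), of "\<lambda>f. fps_nth f n"] arg_cong[OF eqs'(3), of "\<lambda>f. fps_nth f n"]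
          mid[of P P' R R'] mid[of Q Q' Q Q'] less.IH
        by (simp add: nth init init' x_def y_def z_def algebra_simps)
      ultimately have y: "y = (2 - 12 * real n) * x" and z: "z = x + (1 - 3 * real n) * y"
        and "72 * real n ^ 2 * (real n - 1) * x = 0"
        by algebra+
      moreover have "x = 0" if "n = 1" using first that by (simp add: x_def)
      ultimately have "x = 0" using n by auto
      with y z show ?thesis by (simp add: x_def y_def z_def)
    qed (simp add: init init')
  qed
  then show ?thesis by (simp add: fps_eq_iff)
qed

text \<open>
  Both triples satisfy Ramanujan's differential equations, and the first coefficient of the first
  series is \<open>- 24\<close> in both.
\<close>
lemma eis_eq_theta: "eisP = theta_P" "eisQ = theta_Q" "eisR = theta_R"
proof -
  have "eisP = theta_P \<and> eisQ = theta_Q \<and> eisR = theta_R"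
  proof (rule ramanujan_system_unique)
    show "fps_nth eisP 1 = fps_nth theta_P 1"
      by (simp add: eisP_def sig_nth theta_P_nth numeral_fps_const)
  qed (rule fps_XD_eisP fps_XD_eisQ fps_XD_eisR fps_XD_theta_P fps_XD_theta_Q fps_XD_theta_R |
      simp add: theta_P_nth theta_Q_def theta_R_def eisP_def eisQ_def eisR_def
      sig_nth theta_a_nth theta_b_nth fps_nth_power_0
      numeral_fps_const)+
  then show "eisP = theta_P" "eisQ = theta_Q" "eisR = theta_R" by auto
qed

section \<open>The discriminant\<close>

lemma fps_XD_power_Suc:
  "fps_XD (f ^ Suc k) = of_nat (Suc k) * f ^ k * fps_XD (f :: 'a::comm_ring_1 fps)"
  by (induction k) (simp_all add: fps_XD_mult algebra_simps)

text \<open>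
  \<open>L k\<close> is \<open>k q\<^sup>k / (1 - q\<^sup>k)\<close>, the negative of the logarithmic derivative of \<open>1 - q\<^sup>k\<close>.
\<close>
lemma fps_XD_eta_product:
  fixes L :: "nat \<Rightarrow> int fps"
  defines "L \<equiv> \<lambda>k. Abs_fps (\<lambda>n. if n > 0 \<and> k dvd n then int k else 0)"
  shows "fps_XD (\<Prod>m\<le>N. (1 - fps_X ^ Suc m) ^ 24) =
    - 24 * (\<Sum>m\<le>N. L (Suc m)) * (\<Prod>m\<le>N. (1 - fps_X ^ Suc m) ^ 24)"
proof -
  have L: "(1 - fps_X ^ k) * L k = of_nat k * fps_X ^ k" if "k > 0" for k
  proof (rule fps_ext)
    fix n
    have "k dvd n - k \<longleftrightarrow> k dvd n" if "k \<le> n" using that by (simp add: dvd_minus_self)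
    then show "fps_nth ((1 - fps_X ^ k) * L k) n = fps_nth (of_nat k * fps_X ^ k) n"
      using \<open>k > 0\<close> by (auto simp: L_def left_diff_distrib fps_X_power_mult_nth
          fps_mult_of_nat_nth dest: dvd_imp_le)
  qed
  have f: "fps_XD ((1 - fps_X ^ k) ^ 24) = - 24 * L k * (1 - fps_X ^ k) ^ 24" if "k > 0" for k
  proof -
    define u :: "int fps" where "u = 1 - fps_X ^ k"
    have "fps_XD u = - (of_nat k * fps_X ^ k)"
      by (simp add: u_def fps_eq_iff fps_mult_of_nat_nth)
    then have "fps_XD (u ^ 24) = - 24 * u ^ 23 * (u * L k)"
      using fps_XD_power_Suc[of u 23] L[OF that] by (simp add: u_def)
    also have "\<dots> = - 24 * L k * u ^ Suc 23" by (simp only: power_Suc2 ac_simps)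
    finally show ?thesis by (simp add: u_def)
  qed
  have prod: "fps_XD (\<Prod>m\<le>N. g m) = - 24 * (\<Sum>m\<le>N. L (Suc m)) * (\<Prod>m\<le>N. g m)"
    if "\<And>m. fps_XD (g m) = - 24 * L (Suc m) * g m" for g
    by (induction N) (simp_all add: that fps_XD_mult algebra_simps)
  show ?thesis by (rule prod, rule f) simp
qed

lemma eta_product_limit:
  defines "f \<equiv> \<lambda>m. (1 - fps_X ^ Suc m) ^ 24 :: int fps"
  obtains N where "N \<ge> n" "\<And>i. i \<le> n \<Longrightarrow> fps_nth (\<Prod>m\<le>N. f m) i = fps_nth (prodinf f) i"
proof -
  have f0: "fps_nth (f m) 0 = 1" for m by (simp add: f_def fps_nth_power_0)
  have "f has_prod prodinf f" unfolding f_def by (rule ramanujan_tau_has_prod)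
  moreover have "f m \<noteq> 0" for m using f0[of m] by auto
  ultimately have "(\<lambda>N. \<Prod>m\<le>N. f m) \<longlonglongrightarrow> prodinf f"
    by (auto simp: has_prod_def raw_has_prod_def)
  then have "\<forall>\<^sub>F N in sequentially. fps_nth (\<Prod>m\<le>N. f m) i = fps_nth (prodinf f) i" for i
    by (simp add: tendsto_fps_iff)
  then have "\<forall>\<^sub>F N in sequentially. N \<ge> n \<and>
      (\<forall>i\<in>{..n}. fps_nth (\<Prod>m\<le>N. f m) i = fps_nth (prodinf f) i)"
    by (intro eventually_conj eventually_ge_at_top eventually_ball_finite ballI finite_atMost)
  then show ?thesis using that by (auto simp: eventually_sequentially)
qed

lemma fps_XD_ramanujan_tau:
  defines "E \<equiv> Abs_fps (\<lambda>n. if n = 0 then 1 else - 24 * (\<Sum>d | d dvd n. int d))"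
  shows "fps_XD (Abs_fps ramanujan_tau) = E * Abs_fps ramanujan_tau"
proof -
  define f where "f = (\<lambda>m. (1 - fps_X ^ Suc m) ^ 24 :: int fps)"
  define P where "P = prodinf f"
  define L where "L = (\<lambda>k. Abs_fps (\<lambda>n. if n > 0 \<and> k dvd n then int k else 0))"
  have "fps_nth (fps_XD P) n = fps_nth ((E - 1) * P) n" for n
  proof -
    obtain N where N: "N \<ge> n" "\<And>i. i \<le> n \<Longrightarrow> fps_nth (\<Prod>m\<le>N. f m) i = fps_nth P i"
      using eta_product_limit[of n] unfolding f_def P_def by blast
    have E: "fps_nth (- 24 * (\<Sum>m\<le>N. L (Suc m))) i = fps_nth (E - 1) i" if "i \<le> n" for i
    proof (cases "i = 0")
      case False
      have "fps_nth (\<Sum>m\<le>N. L (Suc m)) i = (\<Sum>m\<le>N. if Suc m dvd i then int (Suc m) else 0)"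
        using False by (simp add: fps_sum_nth L_def)
      also have "\<dots> = (\<Sum>m\<in>{..N} \<inter> {m. Suc m dvd i}. int (Suc m))"
        by (simp add: sum.If_cases)
      also have "\<dots> = (\<Sum>d | d dvd i. int d)"
      proof (rule sum.reindex_bij_witness[of _ "\<lambda>d. d - 1" Suc])
        fix d assume "d \<in> {d. d dvd i}"
        then have "0 < d" "d \<le> i" "d dvd i" using False by (auto intro: Nat.gr0I dvd_imp_le)
        then show "Suc (d - 1) = d" "d - 1 \<in> {..N} \<inter> {m. Suc m dvd i}"
          using that N(1) by auto
      qed auto
      finally show ?thesis using False by (simp add: E_def numeral_fps_const)
    qed (simp add: E_def L_def fps_sum_nth numeral_fps_const)
    have "fps_nth (fps_XD P) n = fps_nth (fps_XD (\<Prod>m\<le>N. f m)) n"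
      by (simp add: N(2))
    also have "\<dots> = fps_nth ((- 24 * (\<Sum>m\<le>N. L (Suc m))) * (\<Prod>m\<le>N. f m)) n"
      unfolding f_def L_def by (subst fps_XD_eta_product) rule
    also have "\<dots> = fps_nth ((E - 1) * P) n"
      unfolding fps_mult_nth [of _ "\<Prod>m\<le>N. f m"] fps_mult_nth [of _ P]
    proof (rule sum.cong)
      fix i assume "i \<in> {0..n}"
      then show "fps_nth (- 24 * (\<Sum>m\<le>N. L (Suc m))) i * fps_nth (\<Prod>m\<le>N. f m) (n - i) =
          fps_nth (E - 1) i * fps_nth P (n - i)"
        by (simp only: E N(2) atLeastAtMost_iff diff_le_self)
    qed simp
    finally show ?thesis .
  qed
  then have "P + fps_XD P = E * P" by (simp add: fps_eq_iff left_diff_distrib)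
  moreover have "Abs_fps ramanujan_tau = fps_X * P"
    by (simp add: fps_eq_iff ramanujan_tau_def P_def f_def)
  moreover have "fps_XD (fps_X :: int fps) = fps_X" by (simp add: fps_XD_def)
  ultimately show ?thesis by (simp add: fps_XD_mult mult.left_commute flip: distrib_left)
qed

lemma ramanujan_tau_0: "ramanujan_tau 0 = 0"
  by (simp add: ramanujan_tau_def)

lemma ramanujan_tau_1: "ramanujan_tau 1 = 1"
proof -
  define f where "f = (\<lambda>m. (1 - fps_X ^ Suc m) ^ 24 :: int fps)"
  obtain N where "fps_nth (\<Prod>m\<le>N. f m) 0 = fps_nth (prodinf f) 0"
    using eta_product_limit[of 0] unfolding f_def by blast
  moreover have "fps_nth (f m) 0 = 1" for m by (simp add: f_def fps_nth_power_0)
  ultimately have "fps_nth (prodinf f) 0 = 1" by (simp add: fps_prod_nth')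
  then show ?thesis by (simp add: ramanujan_tau_def f_def)
qed

definition tau_series :: "real fps" where
  "tau_series = Abs_fps (\<lambda>n. real_of_int (ramanujan_tau n))"

lemma fps_XD_tau_series: "fps_XD tau_series = eisP * tau_series"
proof (rule fps_ext)
  fix n
  have "fps_nth (fps_XD tau_series) n = real_of_int (fps_nth (fps_XD (Abs_fps ramanujan_tau)) n)"
    by (simp add: tau_series_def)
  also have "\<dots> = fps_nth (eisP * tau_series) n"
    unfolding fps_XD_ramanujan_tau fps_mult_nth of_int_sum
    by (rule sum.cong) (auto simp: tau_series_def eisP_def sig_nth numeral_fps_const)
  finally show "fps_nth (fps_XD tau_series) n = fps_nth (eisP * tau_series) n" .
qed

text \<open>
  At \<open>q\<^sup>n\<close> the equation reads \<open>(n - 1) f\<^sub>n = \<dots>\<close> with lower coefficients of \<open>f\<close> on the right, so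
  the first coefficient is free and determines the others.
\<close>
lemma fps_XD_eq_mult_unique:
  fixes P f :: "real fps"
  assumes "fps_XD f = P * f" "fps_nth P 0 = 1" "fps_nth f 0 = 0" "fps_nth f 1 = 0"
  shows "f = 0"
proof -
  have "fps_nth f n = 0" for n
  proof (induction n rule: less_induct)
    case (less n)
    show ?case
    proof (cases "n \<le> 1")
      case False
      have "real n * fps_nth f n = fps_nth (P * f) n" by (simp flip: assms(1))
      also have "\<dots> = fps_nth f n"
        using False less.IH assms by (simp add: fps_mult_nth_ends)
      finally show ?thesis using False by simp
    qed (use assms le_Suc_eq in auto)
  qed
  then show ?thesis by (simp add: fps_eq_iff)
qed

lemma tau_series_eq: "16 * tau_series = theta_a * theta_b ^ 4 * (theta_a - theta_b)"
proof -
  let ?F = "theta_a * theta_b ^ 4 * (theta_a - theta_b)"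
  have "6 * fps_XD ?F = 6 * fps_XD theta_a * theta_b ^ 4 * (theta_a - theta_b) +
      4 * theta_a * theta_b ^ 3 * (6 * fps_XD theta_b) * (theta_a - theta_b)
          + theta_a * theta_b ^ 4 * (6 * fps_XD theta_a - 6 * fps_XD theta_b)"
    by (simp add: fps_XD_mult fps_XD_diff eval_nat_numeral algebra_simps)
  also have "\<dots> = 6 * (eisP * ?F)"
    unfolding fps_XD_theta_a fps_XD_theta_b eis_eq_theta(1)
      by (simp add: eval_nat_numeral algebra_simps)
  finally have F: "fps_XD ?F = eisP * ?F"
    by (rule mult_left_cancel[THEN iffD1, rotated]) simp
  have "16 * tau_series - ?F = 0"
  proof (rule fps_XD_eq_mult_unique)
    have "fps_XD (16 * tau_series - ?F) = 16 * fps_XD tau_series - fps_XD ?F"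
      by (simp add: fps_XD_diff fps_XD_mult)
    then show "fps_XD (16 * tau_series - ?F) = eisP * (16 * tau_series - ?F)"
      unfolding F fps_XD_tau_series by (simp add: algebra_simps)
    show "fps_nth eisP 0 = 1" by (simp add: eisP_def sig_nth)
    show "fps_nth (16 * tau_series - ?F) 0 = 0"
      by (simp add: tau_series_def ramanujan_tau_0 theta_a_nth theta_b_nth)
    show "fps_nth (16 * tau_series - ?F) 1 = 0"
      using ramanujan_tau_1
      by (simp add: tau_series_def fps_mult_nth theta_a_nth theta_b_nth fps_nth_power_0 numeral_fps_const)
  qed
  then show ?thesis by simp
qed

section \<open>The number of representations as a sum of 24 squares\<close>

lemma alt_theta_a: "alt theta_a = theta_b" and alt_theta_b: "alt theta_b = theta_a"
  by (simp_all add: theta_a_def theta_b_def alt_power alt_alt)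

lemma alt_tau_series: "16 * alt tau_series = theta_a ^ 4 * theta_b * (theta_b - theta_a)"
proof -
  have "16 * alt tau_series = alt (16 * tau_series)" by (simp add: alt_mult)
  also have "\<dots> = theta_a ^ 4 * theta_b * (theta_b - theta_a)"
    unfolding tau_series_eq
      by (simp add: alt_mult alt_diff alt_power alt_theta_a alt_theta_b mult.commute)
  finally show ?thesis .
qed

text \<open>
  The product of \<open>theta_a\<close>, \<open>theta_b\<close> and their difference only changes by simple factors under
  doubling, because the difference of \<open>4 dbl theta_a\<close> and \<open>4 dbl theta_b\<close> is the square
  \<open>(theta ^ 2 - alt theta ^ 2) ^ 2\<close>.
\<close>
lemma dbl_tau_series: "256 * dbl tau_series = (theta_a * theta_b * (theta_a - theta_b)) ^ 2"
proof -
  have "256 * dbl tau_series = 16 * dbl (16 * tau_series)" by (simp add: dbl_mult)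
  also have "\<dots> = (4 * dbl theta_a) * dbl theta_b ^ 4 * (4 * dbl theta_a - 4 * dbl theta_b)"
    unfolding tau_series_eq by (simp add: dbl_simps algebra_simps)
  also have "\<dots> = (theta_a * theta_b * (theta_a - theta_b)) ^ 2"
    unfolding dbl_theta_a dbl_theta_b
      by (simp add: theta_a_def theta_b_def eval_nat_numeral algebra_simps)
  finally show ?thesis .
qed

lemma dbl_dbl_tau_series: "65536 * dbl (dbl tau_series) =
    theta_a * theta_b * (theta_a - theta_b) ^ 4"
proof -
  have "65536 * dbl (dbl tau_series) = 256 * dbl (256 * dbl tau_series)" by (simp add: dbl_mult)
  also have "\<dots> = (4 * dbl theta_a) ^ 2 * dbl theta_b ^ 2 * (4 * dbl theta_a - 4 * dbl theta_b) ^ 2"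
    unfolding dbl_tau_series by (simp add: dbl_simps algebra_simps power2_eq_square)
  also have "\<dots> = theta_a * theta_b * (theta_a - theta_b) ^ 4"
    unfolding dbl_theta_a dbl_theta_b
      by (simp add: theta_a_def theta_b_def eval_nat_numeral algebra_simps)
  finally show ?thesis .
qed

lemma dbl_theta_R: "2 * dbl theta_R = (theta_a + theta_b) * (2 * theta_b
    - theta_a) * (2 * theta_a - theta_b)"
proof -
  have "2 * dbl theta_R = 12 * (4 * dbl theta_a) ^ 2 * dbl theta_b - 2 * (4 * dbl theta_a) ^ 3
      - 15 * (4 * dbl theta_a) * dbl theta_b ^ 2 - 2 * dbl theta_b ^ 3"
    by (simp add: theta_R_def dbl_simps power_mult_distrib)
  also have "\<dots> = (theta_a + theta_b) * (2 * theta_b - theta_a) * (2 * theta_a - theta_b)"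
    unfolding dbl_theta_a dbl_theta_b
      by (simp add: theta_a_def theta_b_def eval_nat_numeral algebra_simps)
  finally show ?thesis .
qed

lemma dbl_dbl_theta_Q: "16 * dbl (dbl theta_Q) = theta_a ^ 2 + 14 * theta_a * theta_b + theta_b ^ 2"
proof -
  have "16 * dbl (dbl theta_Q) = (4 * dbl theta_a) ^ 2 - 4 * (4 * dbl theta_a) * dbl theta_b
      + 16 * dbl theta_b ^ 2"
    by (simp add: dbl_theta_Q dbl_simps power_mult_distrib)
  also have "\<dots> = theta_a ^ 2 + 14 * theta_a * theta_b + theta_b ^ 2"
    unfolding dbl_theta_a dbl_theta_b
      by (simp add: theta_a_def theta_b_def eval_nat_numeral algebra_simps)
  finally show ?thesis .
qed

lemma dbl_dbl_theta_R: "64 * dbl (dbl theta_R) =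
    (theta_a + theta_b) * (34 * theta_a * theta_b - theta_a ^ 2 - theta_b ^ 2)"
proof -
  have "2 * (64 * dbl (dbl theta_R)) = 64 * dbl (2 * dbl theta_R)" by (simp add: dbl_mult)
  also have "\<dots> = (4 * dbl theta_a + 4 * dbl theta_b) * (8 * dbl theta_b - 4 * dbl theta_a)
      * (2 * (4 * dbl theta_a) - 4 * dbl theta_b)"
    unfolding dbl_theta_R by (simp add: dbl_simps algebra_simps)
  also have "\<dots> = 2 * ((theta_a + theta_b) * (34 * theta_a * theta_b - theta_a ^ 2 - theta_b ^ 2))"
    unfolding dbl_theta_a dbl_theta_b
      by (simp add: theta_a_def theta_b_def eval_nat_numeral algebra_simps)
  finally show ?thesis by (rule mult_left_cancel[THEN iffD1, rotated]) simp
qed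

text \<open>
  By the previous lemmas both sides are polynomials in \<open>theta_a\<close> and \<open>theta_b\<close>, homogeneous of
  degree 6, and they agree as polynomials.  The factor \<open>4096 = 16\<^sup>3 = 64\<^sup>2\<close> clears the denominators
  that doubling twice introduces into \<open>theta_Q\<close> and \<open>theta_R\<close>.
\<close>
lemma theta_power_24:
  defines "E \<equiv> 691 + 65520 * sig 11"
  shows "4095 * (691 * theta ^ 24) = E - 2 * dbl E + 4096 * dbl (dbl E)
    - 4095 * (33152 * alt tau_series + 65536 * dbl tau_series)"
proof -
  have E: "E = 441 * theta_Q ^ 3 + 250 * theta_R ^ 2"
    unfolding E_def eisenstein_12 eis_eq_theta ..
  have E2: "2 * dbl E = 882 * dbl theta_Q ^ 3 + 125 * (2 * dbl theta_R) ^ 2"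
    unfolding E by (simp add: dbl_simps power_mult_distrib)
  have E4: "4096 * dbl (dbl E) = 441 * (16 * dbl (dbl theta_Q)) ^ 3
      + 250 * (64 * dbl (dbl theta_R)) ^ 2"
    unfolding E by (simp add: dbl_simps power_mult_distrib)
  have t: "33152 * alt tau_series + 65536 * dbl tau_series =
      2072 * (16 * alt tau_series) + 256 * (256 * dbl tau_series)"
    by simp
  have theta: "theta ^ 24 = theta_a ^ 6" by (simp add: theta_a_def flip: power_mult)
  show ?thesis
    unfolding theta E2 E4 t
    unfolding E dbl_dbl_theta_Q dbl_dbl_theta_R dbl_tau_series alt_tau_series
    unfolding dbl_theta_Q dbl_theta_R unfolding theta_Q_def theta_R_def
    by (simp add: eval_nat_numeral algebra_simps)
qed

lemma num_reps_Q2: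
  "num_reps Q2 n = fps_nth (theta ^ 24) n"
  using theta_power_nth[where 'k = 24, of n] by (simp add: Q2_def[abs_def])

lemma sigma11_quotient:
  assumes "n > 0" "k > 0"
  shows "sigma11 (real n / real k) = (if k dvd n then fps_nth (sig 11) (n div k) else 0)"
proof (cases "k dvd n")
  case True
  then obtain m where m: "n = k * m" by blast
  then have "real n / real k = real m" using assms by simp
  then show ?thesis using assms m by (simp add: sigma11_def sig_nth)
next
  case False
  have "real n / real k \<notin> \<int>"
  proof
    assume "real n / real k \<in> \<int>"
    then obtain z where "real n / real k = of_int z" by (auto elim: Ints_cases)
    then have "real_of_int (int n) = real_of_int (z * int k)" using assms by (simp add: field_simps)
    then have "int n = z * int k" by (simp only: of_int_eq_iff)
    then have "int k dvd int n" by simp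
    with False show False by simp
  qed
  then show ?thesis using False by (simp add: sigma11_def)
qed

text \<open>
  The coefficient of \<open>q\<^sup>n\<close> in \<open>theta_power_24\<close>, with \<open>33152 = 128 * 259\<close> and \<open>65536 = 128 * 512\<close>.
\<close>
lemma num_reps_Q2_formula:
  assumes "n > 0"
  shows "691 * real (num_reps Q2 n) =
    16 * (sigma11 (real n) - 2 * sigma11 (real n / 2) + 4096 * sigma11 (real n / 4))
    - 128 * real_of_int (259 * (-1) ^ n * ramanujan_tau n
        + 512 * (if even n then ramanujan_tau (n div 2) else 0))"
proof -
  have "4 dvd n \<longleftrightarrow> even n \<and> even (n div 2)" by (auto elim!: evenE)
  then have s: "sigma11 (real n) = fps_nth (sig 11) n"
    "sigma11 (real n / 2) = fps_nth (dbl (sig 11)) n"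
    "sigma11 (real n / 4) = fps_nth (dbl (dbl (sig 11))) n"
    using sigma11_quotient[OF assms, of 1] sigma11_quotient[OF assms, of 2]
      sigma11_quotient[OF assms, of 4]
    by (simp_all add: dbl_nth div_mult2_eq [of n 2 2, simplified])
  have "fps_nth (4095 * (691 * theta ^ 24)) n =
      65520 * (sigma11 (real n) - 2 * sigma11 (real n / 2) + 4096 * sigma11 (real n / 4))
      - 4095 * (33152 * fps_nth (alt tau_series) n + 65536 * fps_nth (dbl tau_series) n)"
    using assms unfolding theta_power_24 dbl_add dbl_mult dbl_numeral
    by (simp add: s numeral_fps_const)
  then show ?thesis
    by (cases "even n") (simp_all add: num_reps_Q2 numeral_fps_const alt_nth dbl_nth tau_series_def)
qed

section \<open>The Hecke relation at 2\<close>

text \<open>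
  As an identity of power series this compares the even part of \<open>tau_series\<close> with its doublings.
  With \<open>a = theta_a\<close>, \<open>b = theta_b\<close> and \<open>c = a - b\<close> it comes down to
  \<open>b\<^sup>3 - a\<^sup>3 = - 3 a b c - c\<^sup>3\<close>.
\<close>
lemma ramanujan_tau_double:
  "ramanujan_tau (2 * m) =
    - 24 * ramanujan_tau m - 2048 * (if even m then ramanujan_tau (m div 2) else 0)"
proof -
  have "16 * (tau_series + alt tau_series) =
      16 * (- 48 * dbl tau_series - 4096 * dbl (dbl tau_series))"
  proof -
    have "16 * (tau_series + alt tau_series) = 16 * tau_series + 16 * alt tau_series"
      by (simp add: algebra_simps)
    also have "\<dots> = - 3 * (256 * dbl tau_series) - 65536 * dbl (dbl tau_series)"
      unfolding dbl_dbl_tau_series dbl_tau_series tau_series_eq alt_tau_series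
      by (simp add: eval_nat_numeral algebra_simps)
    finally show ?thesis by simp
  qed
  then have "tau_series + alt tau_series = - 48 * dbl tau_series - 4096 * dbl (dbl tau_series)"
    by (rule mult_left_cancel[THEN iffD1, rotated]) simp
  from arg_cong[OF this, of "\<lambda>f. fps_nth f (2 * m)"]
  have "real_of_int (2 * ramanujan_tau (2 * m)) = real_of_int (2 *
      (- 24 * ramanujan_tau m - 2048 * (if even m then ramanujan_tau (m div 2) else 0)))"
    by (simp add: tau_series_def alt_nth dbl_nth numeral_fps_const)
  then show ?thesis unfolding of_int_eq_iff by simp
qed

text \<open>
  The recursion \<open>ramanujan_tau_double\<close> divided by powers of 8 reads \<open>w = - 3 v - 32 u\<close>, which keeps
  the cofactors odd.  Hence \<open>2\<close> divides \<open>ramanujan_tau (2 ^ k)\<close> exactly \<open>3 k\<close> times.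
\<close>
lemma ramanujan_tau_power_2:
  assumes "odd m"
  shows "\<exists>u v. odd u \<and> odd v \<and> ramanujan_tau (2 ^ k * m) = 8 ^ k * u * ramanujan_tau m \<and>
    ramanujan_tau (2 ^ Suc k * m) = 8 ^ Suc k * v * ramanujan_tau m"
proof (induction k)
  case 0
  have "ramanujan_tau (2 ^ Suc 0 * m) = 8 ^ Suc 0 * (- 3) * ramanujan_tau m"
    using ramanujan_tau_double[of m] assms by simp
  then show ?case by (intro exI[of _ 1] exI[of _ "- 3"]) simp
next
  case (Suc k)
  then obtain u v where uv: "odd u" "odd v" "ramanujan_tau (2 ^ k * m) =
      8 ^ k * u * ramanujan_tau m"
    "ramanujan_tau (2 ^ Suc k * m) = 8 ^ Suc k * v * ramanujan_tau m" by blast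
  have "ramanujan_tau (2 ^ Suc (Suc k) * m) =
      - 24 * ramanujan_tau (2 ^ Suc k * m) - 2048 * ramanujan_tau (2 ^ k * m)"
    using ramanujan_tau_double[of "2 ^ Suc k * m"] by (simp add: mult.assoc)
  also have "\<dots> = 8 ^ Suc (Suc k) * (- 3 * v - 32 * u) * ramanujan_tau m"
    unfolding uv(3,4) by (simp add: algebra_simps)
  finally show ?case using uv by (intro exI[of _ v] exI[of _ "- 3 * v - 32 * u"]) simp
qed

text \<open>
  For \<open>n = 2\<^sup>k m\<close> with \<open>m\<close> odd and \<open>k > 0\<close> the first term is divisible by fewer powers of 2 than the
  second, apart from the common factor \<open>ramanujan_tau m\<close>.  So there is no cancellation, and both
  sides are equivalent to \<open>ramanujan_tau m = 0\<close>.
\<close>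
lemma tau_term_eq_0_iff:
  assumes "n > 0"
  shows "259 * (-1) ^ n * ramanujan_tau n
      + 512 * (if even n then ramanujan_tau (n div 2) else 0) = 0
    \<longleftrightarrow> ramanujan_tau n = 0"
proof (cases "even n")
  case True
  obtain m where "n = 2 ^ multiplicity 2 n * m" "odd m"
    by (rule multiplicity_decompose'[of n 2]) (use assms in auto)
  then obtain k where km: "n = 2 ^ k * m" "odd m" by blast
  with True obtain j where j: "k = Suc j" by (cases k) auto
  obtain u v where uv: "odd u" "odd v" "ramanujan_tau (2 ^ j * m) = 8 ^ j * u * ramanujan_tau m"
    "ramanujan_tau (2 ^ Suc j * m) = 8 ^ Suc j * v * ramanujan_tau m"
    using ramanujan_tau_power_2[OF km(2), of j] by blast
  have n: "ramanujan_tau n = 8 ^ Suc j * v * ramanujan_tau m" using uv(4) km j by simp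
  moreover have "ramanujan_tau (n div 2) = 8 ^ j * u * ramanujan_tau m" using uv(3) km j by simp
  ultimately have "259 * (-1) ^ n * ramanujan_tau n
      + 512 * (if even n then ramanujan_tau (n div 2) else 0) =
      8 ^ Suc j * (259 * v + 64 * u) * ramanujan_tau m"
    using True by (simp add: algebra_simps)
  moreover have "odd (259 * v + 64 * u)" using uv(2) by simp
  then have "259 * v + 64 * u \<noteq> 0" by (metis even_zero)
  moreover have "v \<noteq> 0" using uv(2) by auto
  ultimately show ?thesis using n by simp
qed simp

theorem theorem1p6:
  fixes n :: nat
  assumes "n > 0"
  shows "real (num_reps Q2 n) =
           16 / 691 * (sigma11 (real n) - 2 * sigma11 (real n / 2) + 4096 * sigma11 (real n / 4))
         \<longleftrightarrow> ramanujan_tau n = 0"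
proof -
  define t where "t = 259 * (-1) ^ n * ramanujan_tau n
    + 512 * (if even n then ramanujan_tau (n div 2) else 0)"
  have "691 * r = 16 * s - 128 * real_of_int t \<Longrightarrow> r = 16 / 691 * s \<longleftrightarrow> t = 0" for r s
    by auto
  from this[OF num_reps_Q2_formula[OF assms, folded t_def]] show ?thesis
    using tau_term_eq_0_iff[OF assms] by (simp add: t_def)
qed

end
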